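(* Assume that $\mathcal{X}\subset\mathbb{R}^d$ is compact; that $f\in\mathcal{H}_{k_0}$ with $\|f\|_{k_0}\le B_0$ and $g_i\in\mathcal{H}_{k_i}$ with $\|g_i\|_{k_i}\le B_i$ for all $i\in[N]$; and that the problem $\min_{x\in\mathcal{X}} f(x)$ subject to $g_i(x)\le 0$ for all $i\in[N]$ is feasible and has an optimal solution $x^*$, with optimal value $f^*=f(x^* )$. Let $\delta\in(0,1)$ and let $T\ge 1$ be the horizon. Then, with probability at least $1-\delta$, the points $x_1,\dots,x_T$ sampled by the CONFIG algorithm satisfy $$R_T\le R_T^+\le 4\beta_{0,T}\sqrt{(T+2)\gamma_{0,T}}=\mathcal{O}(\gamma_{0,T}\sqrt{T}),$$ $$\mathcal{V}_{i,T}\le 4\beta_{i,T}\sqrt{(T+2)\gamma_{i,T}}=\mathcal{O}(\gamma_{i,T}\sqrt{T}),\qquad\forall i\in[N],$$ where $R_T=\sum_{t=1}^T (f(x_t)-f^* )$, $R_T^+=\sum_{t=1}^T[f(x_t)-f^*]^+$ and $\mathcal{V}_{i,T}=\sum_{t=1}^T[g_i(x_t)]^+$. (The $\mathcal{O}(\cdot)$ is as $T\to\infty$, with constants independent of $T$.)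
   Context: Notation: $[N]=\{1,\dots,N\}$, $[a]^+=\max\{0,a\}$. Setting. $\mathcal{X}\subset\mathbb{R}^d$ is a known candidate set; $f$ and $g_i$, $i\in[N]$, are unknown deterministic real-valued functions on it. For $i\in\{0\}\cup[N]$, $k_i:\mathbb{R}^d\times\mathbb{R}^d\to\mathbb{R}$ is a symmetric positive-semidefinite kernel, $\mathcal{H}_{k_i}$ is its reproducing kernel Hilbert space and $\|\cdot\|_{k_i}$ the norm of that space. At step $t$, an algorithm chooses a query point $x_t$ (depending on past observations) and observes $y_{0,t}=f(x_t)+\xi_{0,t}$ and $y_{i,t}=g_i(x_t)+\xi_{i,t}$, $i\in[N]$, where the $\xi_{i,t}$, $i\in\{0\}\cup[N]$, $t\ge1$, are i.i.d. $\sigma$-sub-Gaussian noises with fixed $\sigma>0$. Gaussian process surrogates. With horizon $T$, set $\lambda=1+2/T$. For $i\in\{0\}\cup[N]$ and $t\ge1$ let $k_i(x_{1:t},x)=[k_i(x_1,x),\dots,k_i(x_t,x)]^\top$, let $K_{i,t}$ be the $t\times t$ matrix with entries $k_i(x_a,x_b)$, and $y_{i,1:t}=[y_{i,1},\dots,y_{i,t}]^\top$. Define $$\mu_{i,t}(x)=k_i(x_{1:t},x)^\top(K_{i,t}+\lambda I)^{-1}y_{i,1:t},$$ $$k_{i,t}(x,x')=k_i(x,x')-k_i(x_{1:t},x)^\top(K_{i,t}+\lambda I)^{-1}k_i(x_{1:t},x'),\qquad \sigma_{i,t}^2(x)=k_{i,t}(x,x),$$ with $\mu_{i,0}(x)=0$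 and $\sigma_{i,0}^2(x)=k_i(x,x)$ (the prior mean and variance). Maximum information gain: $\gamma_{i,t}=\max_{X\subset\mathcal{X},\,|X|=t}\frac12\log|I+\lambda^{-1}K_{i,X}|$ with $K_{i,X}=(k_i(x,x'))_{x,x'\in X}$, and $\gamma_{i,0}=0$. Confidence bounds: $\beta_{i,t}=B_i+\sigma\sqrt{2(\gamma_{i,t-1}+1+\ln((N+1)/\delta))}$, $\;l_{i,t}(x)=\mu_{i,t-1}(x)-\beta_{i,t}\sigma_{i,t-1}(x)$, $\;u_{i,t}(x)=\mu_{i,t-1}(x)+\beta_{i,t}\sigma_{i,t-1}(x)$. CONFIG algorithm (horizon $T$, confidence parameter $\delta$). For $t=1,\dots,T$: if there is no $x\in\mathcal{X}$ with $l_{i,t}(x)\le0$ for all $i\in[N]$, declare infeasibility; otherwise choose $x_t\in\arg\min\{l_{0,t}(x): x\in\mathcal{X},\ l_{i,t}(x)\le0\ \forall i\in[N]\}$, observe $y_{0,t},y_{1,t},\dots,y_{N,t}$ at $x_t$, and update the posterior means and covariances.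
   Formalization: The kernels are additionally assumed normalized, k_i(x,x) ≤ 1 on 𝒳 (without a bound of this kind the stated inequality is false), and jointly Borel measurable; γ_{i,t} is the supremum over t-tuples of points of 𝒳, repetitions allowed. *)

theory Defs
  imports
    "HOL-Probability.Probability"
    "HOL-Library.Landau_Symbols"
    "Jordan_Normal_Form.Determinant"
    "Jordan_Normal_Form.Gauss_Jordan_Elimination"
begin

section \<open>Kernels and reproducing kernel Hilbert spaces\<close>

definition psd_kernel :: "('a \<Rightarrow> 'a \<Rightarrow> real) \<Rightarrow> bool" where
  "psd_kernel k \<longleftrightarrow>
     (\<forall>x y. k x y = k y x) \<and>
     (\<forall>S c. finite S \<longrightarrow> (\<Sum>x\<in>S. \<Sum>y\<in>S. c x * c y * k x y) \<ge> 0)"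

text \<open>
  \<open>rkhs k H ip\<close>: the set \<open>H\<close> of real functions with inner product \<open>ip\<close> is a Hilbert space
  in which \<open>k\<close> reproduces point evaluation.  By Moore--Aronszajn, a symmetric positive-semidefinite
  \<open>k\<close> has exactly one such \<open>H\<close>, and \<open>ip\<close> is unique on \<open>H\<close>; the values of \<open>ip\<close> outside \<open>H\<close> are
  irrelevant.
\<close>

definition ip_norm :: "('h \<Rightarrow> 'h \<Rightarrow> real) \<Rightarrow> 'h \<Rightarrow> real" where
  "ip_norm ip h = sqrt (ip h h)"

locale rkhs =
  fixes k :: "'a \<Rightarrow> 'a \<Rightarrow> real"
    and H :: "('a \<Rightarrow> real) set"
    and ip :: "('a \<Rightarrow> real) \<Rightarrow> ('a \<Rightarrow> real) \<Rightarrow> real"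
  assumes zero_mem: "(\<lambda>_. 0) \<in> H"
    and add_mem: "\<lbrakk>u \<in> H; v \<in> H\<rbrakk> \<Longrightarrow> (\<lambda>x. u x + v x) \<in> H"
    and scale_mem: "u \<in> H \<Longrightarrow> (\<lambda>x. c * u x) \<in> H"
    and ip_sym: "\<lbrakk>u \<in> H; v \<in> H\<rbrakk> \<Longrightarrow> ip u v = ip v u"
    and ip_add: "\<lbrakk>u \<in> H; v \<in> H; w \<in> H\<rbrakk> \<Longrightarrow> ip (\<lambda>x. u x + v x) w = ip u w + ip v w"
    and ip_scale: "\<lbrakk>u \<in> H; w \<in> H\<rbrakk> \<Longrightarrow> ip (\<lambda>x. c * u x) w = c * ip u w"
    and ip_nonneg: "u \<in> H \<Longrightarrow> ip u u \<ge> 0"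
    and ip_definite: "\<lbrakk>u \<in> H; ip u u = 0\<rbrakk> \<Longrightarrow> u = (\<lambda>_. 0)"
    and complete: "\<lbrakk>\<And>n. s n \<in> H;
        \<And>e. e > 0 \<Longrightarrow> \<exists>n0. \<forall>m\<ge>n0. \<forall>n\<ge>n0. ip_norm ip (\<lambda>x. s m x - s n x) < e\<rbrakk>
      \<Longrightarrow> \<exists>u\<in>H. (\<lambda>n. ip_norm ip (\<lambda>x. s n x - u x)) \<longlonglongrightarrow> 0"
    and kernel_mem: "k z \<in> H"
    and reproducing: "u \<in> H \<Longrightarrow> ip u (k z) = u z"

section \<open>Noise\<close>

definition sub_gaussian :: "'w measure \<Rightarrow> real \<Rightarrow> ('w \<Rightarrow> real) \<Rightarrow> bool" where
  "sub_gaussian M \<sigma> X \<longleftrightarrow>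
     X \<in> borel_measurable M \<and>
     (\<forall>s. integrable M (\<lambda>\<omega>. exp (s * X \<omega>)) \<and>
          (\<integral>\<omega>. exp (s * X \<omega>) \<partial>M) \<le> exp (\<sigma>\<^sup>2 * s\<^sup>2 / 2))"

text \<open>The noise \<open>\<xi> i t\<close> is indexed by the channel \<open>i \<in> {0..N}\<close> and the step \<open>t \<ge> 1\<close>; the whole
  doubly indexed family is i.i.d.\<close>

definition iid_sub_gaussian_noise ::
    "'w measure \<Rightarrow> nat \<Rightarrow> real \<Rightarrow> (nat \<Rightarrow> nat \<Rightarrow> 'w \<Rightarrow> real) \<Rightarrow> bool" where
  "iid_sub_gaussian_noise M N \<sigma> \<xi> \<longleftrightarrow>
     prob_space.indep_vars M (\<lambda>_. borel) (\<lambda>(i, t). \<xi> i t) ({0..N} \<times> {1..}) \<and>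
     (\<forall>i\<in>{0..N}. \<forall>t\<ge>1. distr M borel (\<xi> i t) = distr M borel (\<xi> 0 1)) \<and>
     (\<forall>i\<in>{0..N}. \<forall>t\<ge>1. sub_gaussian M \<sigma> (\<xi> i t))"

section \<open>Gaussian process surrogates\<close>

text \<open>Queries \<open>x\<close> and observations \<open>y\<close> are sequences indexed from \<open>1\<close>, while matrix and vector
  entries are indexed from \<open>0\<close>; hence the \<open>Suc\<close>.\<close>

definition reg :: "nat \<Rightarrow> real" where
  "reg T = 1 + 2 / real T"

definition kernel_mat :: "('a \<Rightarrow> 'a \<Rightarrow> real) \<Rightarrow> (nat \<Rightarrow> 'a) \<Rightarrow> nat \<Rightarrow> real mat" where
  "kernel_mat k x t = Matrix.mat t t (\<lambda>(a, b). k (x (Suc a)) (x (Suc b)))"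

definition kernel_vec :: "('a \<Rightarrow> 'a \<Rightarrow> real) \<Rightarrow> (nat \<Rightarrow> 'a) \<Rightarrow> nat \<Rightarrow> 'a \<Rightarrow> real Matrix.vec" where
  "kernel_vec k x t z = Matrix.vec t (\<lambda>a. k (x (Suc a)) z)"

text \<open>The matrix inverted here is positive definite whenever \<open>k\<close> is positive semidefinite, so that
  \<open>mat_inverse\<close> does return a result.\<close>

definition reg_kernel_inv ::
    "('a \<Rightarrow> 'a \<Rightarrow> real) \<Rightarrow> nat \<Rightarrow> (nat \<Rightarrow> 'a) \<Rightarrow> nat \<Rightarrow> real mat" where
  "reg_kernel_inv k T x t = the (mat_inverse (kernel_mat k x t + reg T \<cdot>\<^sub>m 1\<^sub>m t))"

text \<open>For \<open>t = 0\<close> all vectors are empty, so the posterior is the prior: mean \<open>0\<close>, covariance \<open>k\<close>.\<close>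

definition post_mean ::
    "('a \<Rightarrow> 'a \<Rightarrow> real) \<Rightarrow> nat \<Rightarrow> (nat \<Rightarrow> 'a) \<Rightarrow> (nat \<Rightarrow> real) \<Rightarrow> nat \<Rightarrow> 'a \<Rightarrow> real" where
  "post_mean k T x y t z =
     kernel_vec k x t z \<bullet> (reg_kernel_inv k T x t *\<^sub>v Matrix.vec t (\<lambda>a. y (Suc a)))"

definition post_cov ::
    "('a \<Rightarrow> 'a \<Rightarrow> real) \<Rightarrow> nat \<Rightarrow> (nat \<Rightarrow> 'a) \<Rightarrow> nat \<Rightarrow> 'a \<Rightarrow> 'a \<Rightarrow> real" where
  "post_cov k T x t z z' =
     k z z' - kernel_vec k x t z \<bullet> (reg_kernel_inv k T x t *\<^sub>v kernel_vec k x t z')"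

definition post_sd ::
    "('a \<Rightarrow> 'a \<Rightarrow> real) \<Rightarrow> nat \<Rightarrow> (nat \<Rightarrow> 'a) \<Rightarrow> nat \<Rightarrow> 'a \<Rightarrow> real" where
  "post_sd k T x t z = sqrt (post_cov k T x t z z)"

text \<open>
  Maximum information gain after \<open>t\<close> queries (with the regularisation of horizon \<open>T\<close>).  The
  maximum ranges over \<open>t\<close>-tuples of points of \<open>X\<close>, repetitions allowed: an algorithm may query a
  point more than once, and a finite \<open>X\<close> has no \<open>t\<close>-element subsets for large \<open>t\<close>.  It is written as
  a supremum, which equals the maximum if that is attained; the set of values is bounded above
  as soon as \<open>k\<close> is bounded on the diagonal of \<open>X\<close>.  For \<open>t = 0\<close> the value is \<open>0\<close>.
\<close>

definition max_info_gain ::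
    "('a \<Rightarrow> 'a \<Rightarrow> real) \<Rightarrow> 'a set \<Rightarrow> nat \<Rightarrow> nat \<Rightarrow> real" where
  "max_info_gain k X T t =
     (SUP x\<in>{x. \<forall>a\<in>{1..t}. x a \<in> X}.
        1 / 2 * ln (Determinant.det (1\<^sub>m t + (1 / reg T) \<cdot>\<^sub>m kernel_mat k x t)))"

definition conf_radius ::
    "('a \<Rightarrow> 'a \<Rightarrow> real) \<Rightarrow> 'a set \<Rightarrow> real \<Rightarrow> real \<Rightarrow> nat \<Rightarrow> real \<Rightarrow> nat \<Rightarrow> nat \<Rightarrow> real" where
  "conf_radius k X B \<sigma> N \<delta> T t =
     B + \<sigma> * sqrt (2 * (max_info_gain k X T (t - 1) + 1 + ln ((real N + 1) / \<delta>)))"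

definition lower_conf ::
    "('a \<Rightarrow> 'a \<Rightarrow> real) \<Rightarrow> 'a set \<Rightarrow> real \<Rightarrow> real \<Rightarrow> nat \<Rightarrow> real \<Rightarrow> nat \<Rightarrow>
       (nat \<Rightarrow> 'a) \<Rightarrow> (nat \<Rightarrow> real) \<Rightarrow> nat \<Rightarrow> 'a \<Rightarrow> real" where
  "lower_conf k X B \<sigma> N \<delta> T x y t z =
     post_mean k T x y (t - 1) z - conf_radius k X B \<sigma> N \<delta> T t * post_sd k T x (t - 1) z"

section \<open>The CONFIG algorithm\<close>

text \<open>The functions are given as one family \<open>h\<close>, with \<open>h 0\<close> the objective and \<open>h i\<close>, \<open>i \<in> {1..N}\<close>,
  the constraints.\<close>

definition observation ::
    "(nat \<Rightarrow> 'a \<Rightarrow> real) \<Rightarrow> (nat \<Rightarrow> nat \<Rightarrow> 'w \<Rightarrow> real) \<Rightarrow> (nat \<Rightarrow> 'w \<Rightarrow> 'a) \<Rightarrow>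
       nat \<Rightarrow> nat \<Rightarrow> 'w \<Rightarrow> real" where
  "observation h \<xi> x i t \<omega> = h i (x t \<omega>) + \<xi> i t \<omega>"

text \<open>All observations made before step \<open>t\<close>; step \<open>1\<close> has the empty history.\<close>

definition history ::
    "nat \<Rightarrow> (nat \<Rightarrow> nat \<Rightarrow> 'w \<Rightarrow> real) \<Rightarrow> nat \<Rightarrow> 'w \<Rightarrow> (nat \<times> nat \<Rightarrow> real)" where
  "history N y t \<omega> = (\<lambda>(i, s)\<in>{0..N} \<times> {1..<t}. y i s \<omega>)"

definition config_lower ::
    "(nat \<Rightarrow> 'a \<Rightarrow> 'a \<Rightarrow> real) \<Rightarrow> 'a set \<Rightarrow> (nat \<Rightarrow> real) \<Rightarrow> real \<Rightarrow> nat \<Rightarrow> real \<Rightarrow> nat \<Rightarrow>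
       (nat \<Rightarrow> 'a \<Rightarrow> real) \<Rightarrow> (nat \<Rightarrow> nat \<Rightarrow> 'w \<Rightarrow> real) \<Rightarrow> (nat \<Rightarrow> 'w \<Rightarrow> 'a) \<Rightarrow>
       nat \<Rightarrow> nat \<Rightarrow> 'w \<Rightarrow> 'a \<Rightarrow> real" where
  "config_lower k X B \<sigma> N \<delta> T h \<xi> x i t \<omega> =
     lower_conf (k i) X (B i) \<sigma> N \<delta> T (\<lambda>s. x s \<omega>) (\<lambda>s. observation h \<xi> x i s \<omega>) t"

text \<open>The auxiliary problem of step \<open>t\<close>; infeasibility is declared when this set is empty.\<close>

definition config_candidates ::
    "(nat \<Rightarrow> 'a \<Rightarrow> 'a \<Rightarrow> real) \<Rightarrow> 'a set \<Rightarrow> (nat \<Rightarrow> real) \<Rightarrow> real \<Rightarrow> nat \<Rightarrow> real \<Rightarrow> nat \<Rightarrow>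
       (nat \<Rightarrow> 'a \<Rightarrow> real) \<Rightarrow> (nat \<Rightarrow> nat \<Rightarrow> 'w \<Rightarrow> real) \<Rightarrow> (nat \<Rightarrow> 'w \<Rightarrow> 'a) \<Rightarrow>
       nat \<Rightarrow> 'w \<Rightarrow> 'a set" where
  "config_candidates k X B \<sigma> N \<delta> T h \<xi> x t \<omega> =
     {z \<in> X. \<forall>i\<in>{1..N}. config_lower k X B \<sigma> N \<delta> T h \<xi> x i t \<omega> z \<le> 0}"

text \<open>
  \<open>x 1, \<dots>, x T\<close> are the query points of a run: \<open>x t\<close> is a measurable function of the past
  observations, and it solves the auxiliary problem of step \<open>t\<close>, by an arbitrary choice among the
  minimisers, unless infeasibility has been declared by then.  After such a declaration the
  algorithm has stopped and the values of \<open>x\<close> are unconstrained dummies.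
\<close>

definition config_run ::
    "'w measure \<Rightarrow> (nat \<Rightarrow> 'a::topological_space \<Rightarrow> 'a \<Rightarrow> real) \<Rightarrow> 'a set \<Rightarrow> (nat \<Rightarrow> real) \<Rightarrow>
       real \<Rightarrow> nat \<Rightarrow> real \<Rightarrow> nat \<Rightarrow> (nat \<Rightarrow> 'a \<Rightarrow> real) \<Rightarrow>
       (nat \<Rightarrow> nat \<Rightarrow> 'w \<Rightarrow> real) \<Rightarrow> (nat \<Rightarrow> 'w \<Rightarrow> 'a) \<Rightarrow> bool" where
  "config_run M k X B \<sigma> N \<delta> T h \<xi> x \<longleftrightarrow>
     (\<forall>t\<in>{1..T}.
        (\<exists>q \<in> borel_measurable (PiM ({0..N} \<times> {1..<t}) (\<lambda>_. borel)).
           \<forall>\<omega>\<in>space M. x t \<omega> = q (history N (observation h \<xi> x) t \<omega>)) \<and>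
        (\<forall>\<omega>\<in>space M.
           (\<forall>s\<in>{1..t}. config_candidates k X B \<sigma> N \<delta> T h \<xi> x s \<omega> \<noteq> {}) \<longrightarrow>
           is_arg_min (config_lower k X B \<sigma> N \<delta> T h \<xi> x 0 t \<omega>)
             (\<lambda>z. z \<in> config_candidates k X B \<sigma> N \<delta> T h \<xi> x t \<omega>) (x t \<omega>)))"

end

theory Submission
  imports Defs
begin

text \<open>
  The posterior mean \<open>\<mu>\<close> and covariance \<open>c\<close> change by rank-one updates with denominator
  \<open>s_t = \<lambda> + c_(t-1)(x_t, x_t)\<close>.  For \<open>f\<close> in the RKHS these updates preserve positivity of the form
  with blocks \<open>Q_t\<close>, \<open>\<mu>_t - f\<close>, \<open>c_t\<close>, where \<open>Q_0\<close> is the squared norm of \<open>f\<close> and \<open>Q_t\<close> grows by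
  \<open>\<xi>_t^2 - (y_t - \<mu>_(t-1)(x_t))^2 / s_t\<close>; hence \<open>(\<mu>_t - f)^2 \<le> Q_t * c_t\<close> at every point.
  The product of the \<open>s_t\<close> is \<open>\<lambda>^t * det (I + K / \<lambda>)\<close>, and dividing the exponential of
  \<open>(Q_t - Q_0) / (2 * \<sigma>^2)\<close> by its square root gives a supermartingale, so that Ville's inequality
  yields the confidence bounds.  Where these hold, the minimiser is always a candidate, each
  regret and violation is at most twice the confidence width, and the posterior variances at the
  queries sum up to at most \<open>4 * \<lambda> * \<gamma>_T\<close>.
\<close>

section \<open>Recursive posterior\<close>

text \<open>Each factor of the supermartingale is a likelihood ratio: the density at
  \<open>y_t\<close> of the predictive Gaussian with mean \<open>\<mu>_(t-1)(x_t)\<close> and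
  variance \<open>\<sigma>^2 * s_t\<close>, over that of the Gaussian with mean
  \<open>f(x_t)\<close> and variance \<open>\<sigma>^2\<close>. For merely sub-Gaussian noise its
  expectation is bounded by 1 after writing the predictive Gaussian as a mixture of Gaussians of
  variance \<open>\<sigma>^2\<close>, which requires \<open>s_t > 1\<close>. The choice
  \<open>\<lambda> = 1 + 2 / T\<close> secures this, while \<open>\<lambda>^T\<close> stays below
  \<open>exp 2\<close>; hence the summand 1 under the root of the confidence radius. One event
  covers all steps, so the union bound only counts the \<open>N + 1\<close> functions. The obstacle
  is a circularity: the gain of the run is below its maximum over \<open>X\<close> only if the
  queries lie in \<open>X\<close>, and this is known only where the confidence bounds hold at
  earlier steps. So the probabilistic estimate speaks of the gain along the path, and membership in
  \<open>X\<close> follows afterwards, by induction on the step.\<close>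

primrec rcov :: "('a \<Rightarrow> 'a \<Rightarrow> real) \<Rightarrow> real \<Rightarrow> (nat \<Rightarrow> 'a) \<Rightarrow> nat \<Rightarrow> 'a \<Rightarrow> 'a \<Rightarrow> real" where
  "rcov k l x 0 = k"
| "rcov k l x (Suc t) = (\<lambda>z z'. rcov k l x t z z' -
     rcov k l x t z (x (Suc t)) * rcov k l x t z' (x (Suc t)) /
       (l + rcov k l x t (x (Suc t)) (x (Suc t))))"

primrec rmean :: "('a \<Rightarrow> 'a \<Rightarrow> real) \<Rightarrow> real \<Rightarrow> (nat \<Rightarrow> 'a) \<Rightarrow> (nat \<Rightarrow> real) \<Rightarrow> nat \<Rightarrow> 'a \<Rightarrow> real" where
  "rmean k l x y 0 = (\<lambda>z. 0)"
| "rmean k l x y (Suc t) = (\<lambda>z. rmean k l x y t z +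
     rcov k l x t z (x (Suc t)) * (y (Suc t) - rmean k l x y t (x (Suc t))) /
       (l + rcov k l x t (x (Suc t)) (x (Suc t))))"

text \<open>The growth of \<open>Q_t\<close> without its initial value: it depends on
  \<open>f\<close> only through the values at the queries, so the probabilistic estimate can be made
  for any measurable \<open>f\<close>.\<close>

primrec energy :: "('a \<Rightarrow> 'a \<Rightarrow> real) \<Rightarrow> real \<Rightarrow> (nat \<Rightarrow> 'a) \<Rightarrow> (nat \<Rightarrow> real) \<Rightarrow> ('a \<Rightarrow> real) \<Rightarrow> nat \<Rightarrow> real" where
  "energy k l x y f 0 = 0"
| "energy k l x y f (Suc t) = energy k l x y f t + (y (Suc t) - f (x (Suc t)))\<^sup>2 -
     (y (Suc t) - rmean k l x y t (x (Suc t)))\<^sup>2 /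
       (l + rcov k l x t (x (Suc t)) (x (Suc t)))"

text \<open>\<open>dominated K Q e\<close>: the kernel \<open>K\<close>, extended to one more point with diagonal value \<open>Q\<close> and
  off-diagonal values \<open>e\<close>, is positive semidefinite.\<close>

definition dominated :: "('a \<Rightarrow> 'a \<Rightarrow> real) \<Rightarrow> real \<Rightarrow> ('a \<Rightarrow> real) \<Rightarrow> bool" where
  "dominated K Q e \<longleftrightarrow> (\<forall>S c a. finite S \<longrightarrow>
     0 \<le> a\<^sup>2 * Q + 2 * a * (\<Sum>z\<in>S. c z * e z) + (\<Sum>z\<in>S. \<Sum>z'\<in>S. c z * c z' * K z z'))"

lemma dominatedD:
  "dominated K Q e \<Longrightarrow> finite S \<Longrightarrow>
     0 \<le> a\<^sup>2 * Q + 2 * a * (\<Sum>z\<in>S. c z * e z) + (\<Sum>z\<in>S. \<Sum>z'\<in>S. c z * c z' * K z z')"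
  by (simp add: dominated_def)

lemma psd_kernel_sym: "psd_kernel k \<Longrightarrow> k x y = k y x"
  by (simp add: psd_kernel_def)

lemma psd_kernel_diag_nonneg:
  assumes "psd_kernel k"
  shows "0 \<le> k x x"
proof -
  have "(\<Sum>z\<in>S. \<Sum>z'\<in>S. c z * c z' * k z z') \<ge> 0" if "finite S" for S c
    using assms that by (simp add: psd_kernel_def)
  from this[of "{x}" "\<lambda>_. 1"] show ?thesis by simp
qed

text \<open>The two weights are added rather than chosen by cases, so that \<open>p\<close> may
  already belong to \<open>S\<close>.\<close>

lemma sum_add_point:
  fixes c e :: "'a \<Rightarrow> real"
  assumes "finite S"
  shows "(\<Sum>z\<in>insert p S. ((if z \<in> S then c z else 0) + (if z = p then d else 0)) * e z) =
    (\<Sum>z\<in>S. c z * e z) + d * e p"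
proof -
  have "(\<Sum>z\<in>insert p S. ((if z \<in> S then c z else 0) + (if z = p then d else 0)) * e z) =
    (\<Sum>z\<in>insert p S. (if z \<in> S then c z * e z else 0)) + (\<Sum>z\<in>insert p S. (if z = p then d * e z else 0))"
    unfolding sum.distrib[symmetric] by (rule sum.cong) (auto simp: algebra_simps)
  also have "(\<Sum>z\<in>insert p S. (if z \<in> S then c z * e z else 0)) = (\<Sum>z\<in>S. c z * e z)"
    using assms by (intro sum.mono_neutral_cong_right) auto
  also have "(\<Sum>z\<in>insert p S. (if z = p then d * e z else 0)) = d * e p"
    using assms by (simp add: sum.delta)
  finally show ?thesis .
qed

lemma quadratic_add_point:
  fixes c :: "'a \<Rightarrow> real" and p :: 'a and d :: real
  assumes "finite S" and sym: "\<And>z z'. K z z' = K z' z"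
  defines "c' \<equiv> (\<lambda>z. (if z \<in> S then c z else 0) + (if z = p then d else 0))"
  shows "(\<Sum>z\<in>insert p S. \<Sum>z'\<in>insert p S. c' z * c' z' * K z z') =
    (\<Sum>z\<in>S. \<Sum>z'\<in>S. c z * c z' * K z z') + 2 * d * (\<Sum>z\<in>S. c z * K z p) + d\<^sup>2 * K p p"
proof -
  have 1: "(\<Sum>z'\<in>insert p S. c' z' * e z') = (\<Sum>z\<in>S. c z * e z) + d * e p" for e :: "'a \<Rightarrow> real"
    unfolding c'_def by (rule sum_add_point) fact
  have "(\<Sum>z\<in>insert p S. \<Sum>z'\<in>insert p S. c' z * c' z' * K z z') =
    (\<Sum>z\<in>insert p S. c' z * (\<Sum>z'\<in>insert p S. c' z' * K z z'))"
    by (simp add: sum_distrib_left mult.assoc)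
  also have "\<dots> = (\<Sum>z\<in>insert p S. c' z * ((\<Sum>z'\<in>S. c z' * K z z') + d * K z p))"
    unfolding 1 ..
  also have "\<dots> = (\<Sum>z\<in>S. c z * ((\<Sum>z'\<in>S. c z' * K z z') + d * K z p)) + d * ((\<Sum>z'\<in>S. c z' * K p z') + d * K p p)"
    by (rule 1)
  also have "(\<Sum>z'\<in>S. c z' * K p z') = (\<Sum>z\<in>S. c z * K z p)"
    by (rule sum.cong) (auto simp: sym)
  finally show ?thesis
    by (simp add: sum_distrib_left sum.distrib algebra_simps power2_eq_square)
qed

text \<open>Positivity read as a quadratic polynomial in the weight \<open>d\<close> added at
  \<open>p\<close>, which can then be chosen freely.\<close>

lemma dominated_add_point:
  assumes "dominated K Q e" "finite S" "\<And>z z'. K z z' = K z' z"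
  shows "0 \<le> (a\<^sup>2 * Q + 2 * a * (\<Sum>z\<in>S. c z * e z) + (\<Sum>z\<in>S. \<Sum>z'\<in>S. c z * c z' * K z z'))
    + 2 * d * (a * e p + (\<Sum>z\<in>S. c z * K z p)) + d\<^sup>2 * K p p"
  using dominatedD[OF assms(1), of "insert p S" a "\<lambda>z. (if z \<in> S then c z else 0) + (if z = p then d else 0)"] assms(2)
  unfolding quadratic_add_point[OF assms(2,3)] sum_add_point[OF assms(2)]
  by (simp add: algebra_simps)

text \<open>Lets \<open>dominated_update\<close> also serve for the covariance alone, with
  \<open>Q\<close>, \<open>e\<close> and \<open>\<xi>\<close> all zero.\<close>

lemma psd_kernel_iff_dominated:
  "psd_kernel K \<longleftrightarrow> (\<forall>x y. K x y = K y x) \<and> dominated K 0 (\<lambda>_. 0)"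
  by (auto simp: psd_kernel_def dominated_def)

text \<open>Let \<open>G\<close> be the old form, \<open>L\<close> half its derivative in the weight at \<open>p\<close>, \<open>b = a * \<xi>\<close> and
  \<open>r = (b - L) / s\<close>.  The new form is \<open>G + b^2 - r^2 * s\<close>, which equals the old form with the weight
  \<open>r\<close> added at \<open>p\<close>, plus \<open>(b - r)^2 + (l - 1) * r^2\<close>.\<close>

lemma dominated_update:
  assumes dom: "dominated K Q e" and sym: "\<And>z z'. K z z' = K z' z" and l: "1 \<le> l" and "0 \<le> K p p"
  shows "dominated (\<lambda>z z'. K z z' - K z p * K z' p / (l + K p p))
    (Q + \<xi>\<^sup>2 - (\<xi> - e p)\<^sup>2 / (l + K p p)) (\<lambda>z. e z + K z p * (\<xi> - e p) / (l + K p p))"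
  unfolding dominated_def
proof (intro allI impI)
  fix S :: "'a set" and c and a :: real
  assume S: "finite S"
  define s where "s = l + K p p"
  have s: "s > 0" using assms by (simp add: s_def)
  define k0 where "k0 = (\<Sum>z\<in>S. c z * K z p)"
  define G where "G = a\<^sup>2 * Q + 2 * a * (\<Sum>z\<in>S. c z * e z) + (\<Sum>z\<in>S. \<Sum>z'\<in>S. c z * c z' * K z z')"
  define L where "L = a * e p + k0"
  define b where "b = a * \<xi>"
  define r where "r = (b - L) / s"
  have rs: "b - L = r * s" using s by (simp add: r_def)
  have "0 \<le> G + 2 * r * L + r\<^sup>2 * K p p"
    using dominated_add_point[OF dom S sym, of a c r p] unfolding G_def L_def k0_def .
  moreover have "0 \<le> (b - r)\<^sup>2 + (l - 1) * r\<^sup>2" using l by simp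
  ultimately have "0 \<le> G + b\<^sup>2 - r\<^sup>2 * s"
  proof -
    have L: "L = b - r * s" using rs by simp
    have K: "K p p = s - l" by (simp add: s_def)
    show ?thesis using \<open>0 \<le> G + 2 * r * L + r\<^sup>2 * K p p\<close> \<open>0 \<le> (b - r)\<^sup>2 + (l - 1) * r\<^sup>2\<close>
      unfolding L K by (simp add: algebra_simps power2_eq_square)
  qed
  also have "r\<^sup>2 * s = (b - L)\<^sup>2 / s" using s by (simp add: rs field_simps power2_eq_square)
  also have "G + b\<^sup>2 - (b - L)\<^sup>2 / s =
    a\<^sup>2 * (Q + \<xi>\<^sup>2 - (\<xi> - e p)\<^sup>2 / s) + 2 * a * (\<Sum>z\<in>S. c z * (e z + K z p * (\<xi> - e p) / s)) +
       (\<Sum>z\<in>S. \<Sum>z'\<in>S. c z * c z' * (K z z' - K z p * K z' p / s))"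
  proof -
    have 1: "(\<Sum>z\<in>S. c z * (e z + K z p * (\<xi> - e p) / s)) = (\<Sum>z\<in>S. c z * e z) + k0 * ((\<xi> - e p) / s)"
      unfolding k0_def sum_distrib_right sum.distrib[symmetric] by (rule sum.cong) (simp_all add: algebra_simps)
    have "(\<Sum>z\<in>S. \<Sum>z'\<in>S. c z * c z' * (K z p * K z' p / s)) = (k0 * k0) / s"
      unfolding k0_def sum_product sum_divide_distrib by (intro sum.cong) simp_all
    then have 2: "(\<Sum>z\<in>S. \<Sum>z'\<in>S. c z * c z' * (K z z' - K z p * K z' p / s)) =
      (\<Sum>z\<in>S. \<Sum>z'\<in>S. c z * c z' * K z z') - (k0 * k0) / s"
      by (simp only: right_diff_distrib sum_subtractf)
    have 3: "a\<^sup>2 * Q + 2 * a * E + D + (a * \<xi>)\<^sup>2 - (a * \<xi> - (a * e p + k0))\<^sup>2 / s =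
      a\<^sup>2 * (Q + \<xi>\<^sup>2 - (\<xi> - e p)\<^sup>2 / s) + 2 * a * (E + k0 * ((\<xi> - e p) / s)) + (D - k0 * k0 / s)" for E D
      using s by (simp add: divide_simps) (simp add: algebra_simps power2_eq_square)
    show ?thesis unfolding 1 2 G_def b_def L_def by (rule 3)
  qed
  finally show "0 \<le> a\<^sup>2 * (Q + \<xi>\<^sup>2 - (\<xi> - e p)\<^sup>2 / (l + K p p)) +
    2 * a * (\<Sum>z\<in>S. c z * (e z + K z p * (\<xi> - e p) / (l + K p p))) +
       (\<Sum>z\<in>S. \<Sum>z'\<in>S. c z * c z' * (K z z' - K z p * K z' p / (l + K p p)))"
    unfolding s_def .
qed

lemma quadratic_nonneg_bound:
  fixes e K b :: real
  assumes "0 \<le> K" and nonneg: "\<And>d. 0 \<le> e + 2 * d * b + d\<^sup>2 * K"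
  shows "b\<^sup>2 \<le> e * K"
proof (cases "K = 0")
  case True
  have "b = 0"
  proof (rule ccontr)
    assume "b \<noteq> 0"
    \<comment> \<open>With no quadratic term, this \<open>d\<close> makes the value -1.\<close>
    then show False using nonneg[of "- (e + 1) / (2 * b)"] True by (simp add: field_simps)
  qed
  then show ?thesis using True by simp
next
  case False
  then have K: "K > 0" using assms by simp
  have "0 \<le> e + 2 * (- b / K) * b + (- b / K)\<^sup>2 * K" by (rule nonneg)
  also have "\<dots> = e - b\<^sup>2 / K" using K by (simp add: field_simps power2_eq_square)
  finally show ?thesis using K by (simp add: field_simps)
qed

text \<open>Positivity on the extra point and \<open>z\<close> alone is a 2x2 determinant
  condition.\<close>

lemma dominated_bound:
  assumes "dominated K Q e"
  shows "(e z)\<^sup>2 \<le> Q * K z z"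
proof (rule quadratic_nonneg_bound)
  have *: "0 \<le> a\<^sup>2 * Q + 2 * a * (c * e z) + c * c * K z z" for a c
    using dominatedD[OF assms, of "{z}" a "\<lambda>_. c"] by simp
  show "0 \<le> K z z" using *[of 0 1] by simp
  show "0 \<le> Q + 2 * d * e z + d\<^sup>2 * K z z" for d
    using *[of 1 d] by (simp add: power2_eq_square mult.assoc)
qed

section \<open>Invariants of the recursive posterior\<close>

lemma psd_rcov:
  assumes "psd_kernel k" "1 \<le> l"
  shows "psd_kernel (rcov k l x t)"
proof (induction t)
  case (Suc t)
  show ?case
    using dominated_update[of "rcov k l x t" 0 "\<lambda>_. 0" l "x (Suc t)" 0] Suc assms
      psd_kernel_diag_nonneg[OF Suc]
    by (auto simp: psd_kernel_iff_dominated mult.commute)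
qed (use assms in simp)

lemma rcov_sym: "psd_kernel k \<Longrightarrow> 1 \<le> l \<Longrightarrow> rcov k l x t z z' = rcov k l x t z' z"
  by (rule psd_kernel_sym[OF psd_rcov])

lemma rcov_nonneg: "psd_kernel k \<Longrightarrow> 1 \<le> l \<Longrightarrow> 0 \<le> rcov k l x t z z"
  by (rule psd_kernel_diag_nonneg[OF psd_rcov])

lemma rcov_le:
  assumes "psd_kernel k" "1 \<le> l"
  shows "rcov k l x t z z \<le> k z z"
proof (induction t)
  case (Suc t)
  then show ?case using rcov_nonneg[OF assms, of x t "x (Suc t)"] assms(2)
    by (simp add: add_nonneg_nonneg order_trans[rotated, OF Suc])
qed simp

text \<open>With the noise as \<open>\<xi>\<close> and the error of the mean as \<open>e\<close>,
  the difference \<open>\<xi> - e p\<close> is the prediction residual, so the update of the form is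
  exactly that of \<open>rmean\<close> and \<open>energy\<close>. The initial mean 0 explains the
  initial error \<open>- f z\<close>.\<close>

lemma rmean_dominated:
  assumes "psd_kernel k" "1 \<le> l" "dominated k Q (\<lambda>z. - f z)"
  shows "dominated (rcov k l x t) (Q + energy k l x y f t) (\<lambda>z. rmean k l x y t z - f z)"
proof (induction t)
  case (Suc t)
  show ?case
    using dominated_update[OF Suc rcov_sym[OF assms(1,2)] assms(2) rcov_nonneg[OF assms(1,2)],
        of "x (Suc t)" "y (Suc t) - f (x (Suc t))"]
    by (simp add: algebra_simps)
qed (use assms in simp)

text \<open>The subtracted part of the covariance is the mean computed from the data
  \<open>k (x j) z'\<close>. Thus a matrix formula for the mean with arbitrary data covers the
  covariance as well.\<close>

lemma rcov_eq_rmean: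
  assumes "psd_kernel k" "1 \<le> l"
  shows "rcov k l x t z z' = k z z' - rmean k l x (\<lambda>j. k (x j) z') t z"
proof (induction t arbitrary: z)
  case (Suc t)
  show ?case
    using Suc[of z] Suc[of "x (Suc t)"] rcov_sym[OF assms, of x t z' "x (Suc t)"] by simp
qed simp

section \<open>The matrix formulas for the posterior\<close>

text \<open>Bordering: the system of size \<open>t + 1\<close> is solved by correcting the old
  solution with a multiple of the solution for the new kernel column. The step needs two data
  sequences at once, hence the induction with arbitrary \<open>y\<close>.\<close>

lemma posterior_solution:
  assumes k: "psd_kernel k" and l: "1 \<le> l"
  shows "\<exists>q. (\<forall>a<t. (\<Sum>b<t. k (x (Suc a)) (x (Suc b)) * q b) + l * q a = y (Suc a)) \<and>
             (\<forall>z. (\<Sum>a<t. k (x (Suc a)) z * q a) = rmean k l x y t z)"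
proof (induction t arbitrary: y)
  case (Suc t)
  let ?p = "x (Suc t)"
  define s where "s = l + rcov k l x t ?p ?p"
  have s: "s > 0" using rcov_nonneg[OF k l, of x t ?p] l by (simp add: s_def)
  obtain q where q: "\<And>a. a < t \<Longrightarrow> (\<Sum>b<t. k (x (Suc a)) (x (Suc b)) * q b) + l * q a = y (Suc a)"
    and qm: "\<And>z. (\<Sum>a<t. k (x (Suc a)) z * q a) = rmean k l x y t z"
    using Suc[of y] by auto
  obtain r where r: "\<And>a. a < t \<Longrightarrow> (\<Sum>b<t. k (x (Suc a)) (x (Suc b)) * r b) + l * r a = k (x (Suc a)) ?p"
    and rm: "\<And>z. (\<Sum>a<t. k (x (Suc a)) z * r a) = k z ?p - rcov k l x t z ?p"
    using Suc[of "\<lambda>j. k (x j) ?p"] unfolding rcov_eq_rmean[OF k l] by auto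
  \<comment> \<open>The last coordinate of the new solution: the prediction residual over the Schur
    complement \<open>s\<close>.\<close>
  define \<rho> where "\<rho> = (y (Suc t) - rmean k l x y t ?p) / s"
  define w where "w a = (if a < t then q a - \<rho> * r a else \<rho>)" for a
  have w: "(\<Sum>a<Suc t. c a * w a) = (\<Sum>a<t. c a * q a) - \<rho> * (\<Sum>a<t. c a * r a) + c t * \<rho>" for c
  proof -
    have "(\<Sum>a<t. c a * w a) = (\<Sum>a<t. c a * q a - \<rho> * (c a * r a))"
      by (rule sum.cong) (auto simp: w_def algebra_simps)
    then show ?thesis by (simp add: sum_subtractf sum_distrib_left w_def)
  qed
  show ?case
  proof (intro exI[of _ w] conjI allI impI)
    fix z
    have "(\<Sum>a<Suc t. k (x (Suc a)) z * w a) =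
        rmean k l x y t z - \<rho> * (k z ?p - rcov k l x t z ?p) + k ?p z * \<rho>"
      unfolding w qm rm ..
    also have "\<dots> = rmean k l x y t z + rcov k l x t z ?p * \<rho>"
      by (simp add: psd_kernel_sym[OF k, of ?p z] algebra_simps)
    finally show "(\<Sum>a<Suc t. k (x (Suc a)) z * w a) = rmean k l x y (Suc t) z"
      by (simp add: \<rho>_def s_def)
  next
    fix a assume a: "a < Suc t"
    show "(\<Sum>b<Suc t. k (x (Suc a)) (x (Suc b)) * w b) + l * w a = y (Suc a)"
    proof (cases "a < t")
      case True
      have wa: "w a = q a - \<rho> * r a" using True by (simp add: w_def)
      have 1: "(\<Sum>b<t. k (x (Suc a)) (x (Suc b)) * q b) = y (Suc a) - l * q a"
        using q[OF True] by simp
      have 2: "(\<Sum>b<t. k (x (Suc a)) (x (Suc b)) * r b) = k (x (Suc a)) ?p - l * r a"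
        using r[OF True] by simp
      show ?thesis unfolding w wa 1 2 by (simp add: algebra_simps)
    next
      case False
      then have a: "a = t" using a by simp
      have "(\<Sum>b<Suc t. k ?p (x (Suc b)) * w b) = (\<Sum>b<Suc t. k (x (Suc b)) ?p * w b)"
        by (rule sum.cong) (simp_all add: psd_kernel_sym[OF k, of ?p])
      also have "\<dots> = rmean k l x y t ?p - \<rho> * (k ?p ?p - rcov k l x t ?p ?p) + k ?p ?p * \<rho>"
        unfolding w qm rm ..
      finally have 1: "(\<Sum>b<Suc t. k ?p (x (Suc b)) * w b) =
        rmean k l x y t ?p - \<rho> * (k ?p ?p - rcov k l x t ?p ?p) + k ?p ?p * \<rho>" .
      have 2: "w t = \<rho>" by (simp add: w_def)
      have 3: "\<rho> * s = y (Suc t) - rmean k l x y t ?p" using s by (simp add: \<rho>_def)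
      show ?thesis unfolding a 1 2 using 3 by (simp add: s_def algebra_simps)
    qed
  qed
qed simp

section \<open>Determinant and inverse of the regularised kernel matrix\<close>

abbreviation "reg_mat k l x t \<equiv> kernel_mat k x t + l \<cdot>\<^sub>m 1\<^sub>m t"

lemma reg_mat_mult_vec:
  assumes "\<And>a. a < t \<Longrightarrow> (\<Sum>b<t. k (x (Suc a)) (x (Suc b)) * q b) + l * q a = v a"
  shows "reg_mat k l x t *\<^sub>v Matrix.vec t q = Matrix.vec t v"
proof (rule eq_vecI)
  fix a assume a: "a < dim_vec (Matrix.vec t v)"
  then have a: "a < t" by simp
  have "Matrix.vec_index (reg_mat k l x t *\<^sub>v Matrix.vec t q) a =
      (\<Sum>b<t. (k (x (Suc a)) (x (Suc b)) + (if a = b then l else 0)) * q b)"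
    using a by (simp add: scalar_prod_def kernel_mat_def lessThan_atLeast0) (rule sum.cong; simp)
  also have "\<dots> = (\<Sum>b<t. k (x (Suc a)) (x (Suc b)) * q b) + l * q a"
    using a by (simp add: distrib_right sum.distrib if_distrib[of "\<lambda>u. u * _"] cong: if_cong)
  also have "\<dots> = v a" using assms a by simp
  finally show "Matrix.vec_index (reg_mat k l x t *\<^sub>v Matrix.vec t q) a = Matrix.vec_index (Matrix.vec t v) a"
    using a by simp
qed (simp add: kernel_mat_def)

lemma scalar_prod_vec: "Matrix.vec t u \<bullet> Matrix.vec t v = (\<Sum>a<t. u a * v a)"
  by (simp add: scalar_prod_def lessThan_atLeast0)

text \<open>Solving for the last column gives a block LU factorisation whose last pivot is the Schur
  complement \<open>s\<close>, so each query contributes one factor.\<close>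

lemma det_reg_mat:
  assumes k: "psd_kernel k" and l: "1 \<le> l"
  shows "Determinant.det (reg_mat k l x t) = (\<Prod>j<t. l + rcov k l x j (x (Suc j)) (x (Suc j)))"
proof (induction t)
  case 0
  have "reg_mat k l x 0 \<in> carrier_mat 0 0" by (simp add: kernel_mat_def)
  then show ?case by simp
next
  case (Suc t)
  let ?p = "x (Suc t)"
  define s where "s = l + rcov k l x t ?p ?p"
  obtain r where r: "\<And>a. a < t \<Longrightarrow> (\<Sum>b<t. k (x (Suc a)) (x (Suc b)) * r b) + l * r a = k (x (Suc a)) ?p"
    and rm: "(\<Sum>a<t. k (x (Suc a)) ?p * r a) = k ?p ?p - rcov k l x t ?p ?p"
    using posterior_solution[OF k l, of t x "\<lambda>j. k (x j) ?p"] unfolding rcov_eq_rmean[OF k l] by auto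
  define A where "A = reg_mat k l x t"
  define W where "W = Matrix.mat 1 t (\<lambda>(_, b). k ?p (x (Suc b)))"
  define R where "R = Matrix.mat t 1 (\<lambda>(a, _). r a)"
  define S where "S = Matrix.mat 1 1 (\<lambda>_. s)"
  define L where "L = four_block_mat A (0\<^sub>m t 1) W (1\<^sub>m 1)"
  define U where "U = four_block_mat (1\<^sub>m t) R (0\<^sub>m 1 t) S"
  have car: "A \<in> carrier_mat t t" "W \<in> carrier_mat 1 t" "R \<in> carrier_mat t 1" "S \<in> carrier_mat 1 1"
    by (auto simp: A_def W_def R_def S_def kernel_mat_def)
  have LU: "L * U = four_block_mat A (A * R) W (W * R + S)"
    unfolding L_def U_def using car
    by (subst mult_four_block_mat[of _ t t _ 1 _ 1 _ _ t _ 1]) auto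
  have AR: "A * R = Matrix.mat t 1 (\<lambda>(a, _). k (x (Suc a)) ?p)"
  proof (rule eq_matI)
    fix a b assume "a < dim_row (Matrix.mat t 1 (\<lambda>(a, _). k (x (Suc a)) ?p))"
      "b < dim_col (Matrix.mat t 1 (\<lambda>(a, _). k (x (Suc a)) ?p))"
    then have a: "a < t" "b = 0" by auto
    have "col R 0 = Matrix.vec t r" by (auto simp: R_def)
    then have "(A * R) $$ (a, b) = Matrix.vec_index (A *\<^sub>v Matrix.vec t r) a"
      using a carrier_matD[OF car(1)] carrier_matD[OF car(3)] by simp
    also have "\<dots> = k (x (Suc a)) ?p"
      using a unfolding A_def by (subst reg_mat_mult_vec[where v = "\<lambda>a. k (x (Suc a)) ?p"]) (auto simp: r)
    finally show "(A * R) $$ (a, b) = Matrix.mat t 1 (\<lambda>(a, _). k (x (Suc a)) ?p) $$ (a, b)"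
      using a by simp
  qed (use car in auto)
  have rR: "W * R + S = Matrix.mat 1 1 (\<lambda>_. k ?p ?p + l)"
  proof (rule eq_matI)
    fix a b assume "a < dim_row (Matrix.mat 1 1 (\<lambda>_. k ?p ?p + l))" "b < dim_col (Matrix.mat 1 1 (\<lambda>_. k ?p ?p + l))"
    then have a: "a = 0" "b = 0" by auto
    have "(W * R) $$ (0, 0) = (\<Sum>b<t. k (x (Suc b)) ?p * r b)"
      using car by (simp add: scalar_prod_def W_def R_def lessThan_atLeast0 psd_kernel_sym[OF k, of ?p])
    then show "(W * R + S) $$ (a, b) = Matrix.mat 1 1 (\<lambda>_. k ?p ?p + l) $$ (a, b)"
      using a car rm by (simp add: S_def s_def)
  qed (use car in auto)
  have "reg_mat k l x (Suc t) = L * U"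
    unfolding LU AR rR
    by (rule eq_matI) (auto simp: A_def W_def kernel_mat_def less_Suc_eq)
  also have "Determinant.det (L * U) = Determinant.det L * Determinant.det U"
    using car by (intro det_mult[of _ "Suc t"]) (auto simp: L_def U_def)
  also have "Determinant.det L = Determinant.det A"
    unfolding L_def using car by (subst det_four_block_mat_upper_right_zero[of _ t _ 1]) auto
  also have "Determinant.det U = s"
    unfolding U_def using car by (subst det_four_block_mat_lower_left_zero[of _ t _ 1]) (auto simp: S_def det_single)
  finally show ?case using Suc by (simp add: A_def s_def)
qed

lemma reg_ge_one: "1 \<le> reg T"
  by (simp add: reg_def)

text \<open>The determinant is a product of positive factors, so \<open>mat_inverse\<close> does not
  return \<open>None\<close> and the selection by \<open>the\<close> is meaningful.\<close>

lemma reg_kernel_inv_mult: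
  assumes k: "psd_kernel k" 
    and q: "\<And>a. a < t \<Longrightarrow> (\<Sum>b<t. k (x (Suc a)) (x (Suc b)) * q b) + reg T * q a = v a"
  shows "reg_kernel_inv k T x t *\<^sub>v Matrix.vec t v = Matrix.vec t q"
proof -
  let ?A = "reg_mat k (reg T) x t"
  have A: "?A \<in> carrier_mat t t" by (simp add: kernel_mat_def)
  have "Determinant.det ?A \<noteq> 0"
    using rcov_nonneg[OF k reg_ge_one[of T], where x=x] reg_ge_one[of T] unfolding det_reg_mat[OF k reg_ge_one]
    by (auto simp: add_nonneg_eq_0_iff)
  then have "?A \<in> Units (ring_mat TYPE(real) t ())"
    by (rule det_non_zero_imp_unit[OF A])
  then have "mat_inverse ?A \<noteq> None"
    using mat_inverse(1)[OF A] by metis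
  then obtain I where I: "mat_inverse ?A = Some I" by auto
  have I2: "I * ?A = 1\<^sub>m t" "I \<in> carrier_mat t t" using mat_inverse(2)[OF A I] by auto
  have "I *\<^sub>v Matrix.vec t v = I *\<^sub>v (?A *\<^sub>v Matrix.vec t q)"
    by (subst reg_mat_mult_vec[where v = v]) (simp_all add: q)
  also have "\<dots> = (I * ?A) *\<^sub>v Matrix.vec t q"
    using I2 A by (subst assoc_mult_mat_vec) auto
  also have "\<dots> = Matrix.vec t q" unfolding I2 by simp
  finally show ?thesis by (simp add: reg_kernel_inv_def I)
qed

lemma post_mean_eq_rmean:
  assumes k: "psd_kernel k"
  shows "post_mean k T x y t z = rmean k (reg T) x y t z"
proof -
  obtain q where q: "\<And>a. a < t \<Longrightarrow> (\<Sum>b<t. k (x (Suc a)) (x (Suc b)) * q b) + reg T * q a = y (Suc a)"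
    "(\<Sum>a<t. k (x (Suc a)) z * q a) = rmean k (reg T) x y t z"
    using posterior_solution[OF k reg_ge_one[of T], where x=x and y=y and t=t] by auto
  have "reg_kernel_inv k T x t *\<^sub>v Matrix.vec t (\<lambda>a. y (Suc a)) = Matrix.vec t q"
    by (rule reg_kernel_inv_mult[OF k q(1)])
  then show ?thesis
    using q(2) by (simp add: post_mean_def kernel_vec_def scalar_prod_vec)
qed

lemma post_cov_eq_rcov:
  assumes k: "psd_kernel k"
  shows "post_cov k T x t z z' = rcov k (reg T) x t z z'"
  using post_mean_eq_rmean[OF k, of T x "\<lambda>j. k (x j) z'" t z]
  unfolding rcov_eq_rmean[OF k reg_ge_one] post_cov_def post_mean_def kernel_vec_def by simp

text \<open>Half the log-determinant in chain-rule form, for one fixed sequence of queries.\<close>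

definition info_gain :: "('a \<Rightarrow> 'a \<Rightarrow> real) \<Rightarrow> real \<Rightarrow> (nat \<Rightarrow> 'a) \<Rightarrow> nat \<Rightarrow> real" where
  "info_gain k l x t = (\<Sum>j<t. ln (1 + rcov k l x j (x (Suc j)) (x (Suc j)) / l)) / 2"

lemma ln_det_eq_info_gain:
  assumes k: "psd_kernel k"
  shows "1 / 2 * ln (Determinant.det (1\<^sub>m t + (1 / reg T) \<cdot>\<^sub>m kernel_mat k x t)) = info_gain k (reg T) x t"
proof -
  let ?l = "reg T" and ?D = "1\<^sub>m t + (1 / reg T) \<cdot>\<^sub>m kernel_mat k x t"
  let ?c = "\<lambda>j. rcov k ?l x j (x (Suc j)) (x (Suc j))"
  have l: "?l > 0" using reg_ge_one[of T] by simp
  have "reg_mat k ?l x t = ?l \<cdot>\<^sub>m ?D"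
    using l by (intro eq_matI) (auto simp: kernel_mat_def algebra_simps)
  then have "(\<Prod>j<t. ?l + ?c j) = ?l ^ t * Determinant.det ?D"
    using det_reg_mat[OF k reg_ge_one[of T], where x=x and t=t] by (simp add: kernel_mat_def)
  also have "(\<Prod>j<t. ?l + ?c j) = (\<Prod>j<t. ?l * (1 + ?c j / ?l))"
    using l by (intro prod.cong) (auto simp: field_simps)
  finally have "Determinant.det ?D = (\<Prod>j<t. 1 + ?c j / ?l)"
    using l by (simp add: prod.distrib)
  moreover have "1 + ?c j / ?l > 0" for j
    using rcov_nonneg[OF k reg_ge_one[of T], where x=x and t=j] l by (simp add: add_pos_nonneg)
  ultimately show ?thesis by (simp add: info_gain_def) (rule ln_prod; simp add: less_imp_neq[symmetric])
qed

section \<open>Functions in a reproducing kernel Hilbert space\<close>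

context rkhs
begin

lemma span_mem: "finite S \<Longrightarrow> (\<lambda>x. \<Sum>z\<in>S. c z * k z x) \<in> H"
proof (induction S rule: finite_induct)
  case (insert p S)
  have "(\<lambda>x. c p * k p x + (\<Sum>z\<in>S. c z * k z x)) \<in> H"
    by (intro add_mem scale_mem kernel_mem insert.IH)
  then show ?case using insert.hyps by simp
qed (simp add: zero_mem)

lemma ip_span: "finite S \<Longrightarrow> w \<in> H \<Longrightarrow> ip (\<lambda>x. \<Sum>z\<in>S. c z * k z x) w = (\<Sum>z\<in>S. c z * w z)"
proof (induction S rule: finite_induct)
  case empty
  then show ?case using ip_scale[OF zero_mem, of w 0] by simp
next
  case (insert p S)
  have "ip (\<lambda>x. c p * k p x + (\<Sum>z\<in>S. c z * k z x)) w = c p * w p + (\<Sum>z\<in>S. c z * w z)"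
    using insert by (subst ip_add)
      (auto intro: scale_mem kernel_mem span_mem simp: ip_scale ip_sym[of "k p" w] reproducing kernel_mem)
  then show ?case using insert by simp
qed

text \<open>The form is the squared norm of the combination of kernel sections with weights
  \<open>c\<close>, minus \<open>a\<close> times \<open>f\<close>.\<close>

lemma dominated_neg:
  assumes f: "f \<in> H"
  shows "dominated k (ip f f) (\<lambda>z. - f z)"
  unfolding dominated_def
proof (intro allI impI)
  fix S c and a :: real assume S: "finite (S :: 'a set)"
  define v where "v = (\<lambda>x. \<Sum>z\<in>S. c z * k z x)"
  define g where "g = (\<lambda>x. - a * f x)"
  have v: "v \<in> H" unfolding v_def by (rule span_mem[OF S])
  have g: "g \<in> H" unfolding g_def by (rule scale_mem[OF f])
  have vg: "(\<lambda>x. v x + g x) \<in> H" by (rule add_mem[OF v g])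
  have v_ip: "ip v w = (\<Sum>z\<in>S. c z * w z)" if "w \<in> H" for w
    unfolding v_def by (rule ip_span[OF S that])
  have fv: "ip f v = (\<Sum>z\<in>S. c z * f z)" using ip_sym[OF f v] v_ip[OF f] by simp
  have gw: "ip g w = - a * ip f w" if "w \<in> H" for w
    unfolding g_def by (rule ip_scale[OF f that])
  have gf: "ip f g = - a * ip f f" using ip_sym[OF f g] gw[OF f] by simp
  have "ip (\<lambda>x. v x + g x) (\<lambda>x. v x + g x) = ip v (\<lambda>x. v x + g x) + ip g (\<lambda>x. v x + g x)"
    by (rule ip_add[OF v g vg])
  also have "ip v (\<lambda>x. v x + g x) = ip v v + ip v g"
    using ip_sym[OF v vg] ip_add[OF v g v] ip_sym[OF g v] by simp
  also have "ip g (\<lambda>x. v x + g x) = - a * (ip f v + ip f g)"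
    using gw[OF vg] ip_sym[OF f vg] ip_add[OF v g f] ip_sym[OF f v] ip_sym[OF f g] by simp
  also have "ip v v = (\<Sum>z\<in>S. \<Sum>z'\<in>S. c z * c z' * k z' z)"
    unfolding v_ip[OF v] by (simp add: v_def sum_distrib_left mult.assoc)
  also have "\<dots> = (\<Sum>z\<in>S. \<Sum>z'\<in>S. c z * c z' * k z z')"
    by (subst sum.swap) (simp add: mult.commute mult.left_commute)
  also have "ip v g = - a * (\<Sum>z\<in>S. c z * f z)"
    unfolding v_ip[OF g] by (simp add: g_def sum_distrib_left algebra_simps)
  finally have "ip (\<lambda>x. v x + g x) (\<lambda>x. v x + g x) =
    a\<^sup>2 * ip f f + 2 * a * (\<Sum>z\<in>S. c z * - f z) + (\<Sum>z\<in>S. \<Sum>z'\<in>S. c z * c z' * k z z')"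
    by (simp add: fv gf sum_negf power2_eq_square algebra_simps)
  then show "0 \<le> a\<^sup>2 * ip f f + 2 * a * (\<Sum>z\<in>S. c z * - f z) + (\<Sum>z\<in>S. \<Sum>z'\<in>S. c z * c z' * k z z')"
    using ip_nonneg[OF vg] by simp
qed

end

text \<open>A sequence in the span of the kernel sections that minimises the distance to \<open>f\<close> in the
  quadratic form converges to \<open>f\<close> pointwise, since any error at a point \<open>p\<close> could be reduced
  by adding a multiple of \<open>k p\<close>.\<close>

lemma dominated_measurable:
  fixes k :: "'a::topological_space \<Rightarrow> 'a \<Rightarrow> real"
  assumes dom: "dominated k Q (\<lambda>z. - f z)" and k: "psd_kernel k"
    and meas: "\<And>z. (\<lambda>x. k z x) \<in> borel_measurable borel"
  shows "f \<in> borel_measurable borel"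
proof -
  \<comment> \<open>When \<open>Q\<close> is the squared norm of \<open>f\<close>, this is the
    squared distance from \<open>f\<close> to the combination with weights \<open>c\<close>.\<close>
  define q where "q = (\<lambda>(S, c). Q - 2 * (\<Sum>z\<in>S. c z * f z) + (\<Sum>z\<in>S. \<Sum>z'\<in>S. c z * c z' * k z z'))"
  define A where "A = q ` {(S, c). finite S}"
  have A0: "0 \<le> a" if "a \<in> A" for a
    using that dominatedD[OF dom, of _ 1] by (auto simp: A_def q_def sum_negf)
  then have bdd: "bdd_below A" by (meson bdd_below.I)
  have "q ({}, \<lambda>_. 0) \<in> A" unfolding A_def by (rule imageI) simp
  then have ne: "A \<noteq> {}" by blast
  have "\<exists>S c. finite S \<and> q (S, c) < Inf A + 1 / real (Suc n)" for n
  proof -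
    have "Inf A < Inf A + 1 / real (Suc n)" by simp
    from cInf_lessD[OF ne this] show ?thesis unfolding A_def by auto
  qed
  then obtain S c where S: "\<And>n. finite (S n)" and q: "\<And>n. q (S n, c n) < Inf A + 1 / real (Suc n)"
    by metis
  define v where "v n x = (\<Sum>z\<in>S n. c n z * k z x)" for n x
  have v_meas: "v n \<in> borel_measurable borel" for n
    unfolding v_def using meas by measurable
  have v_lim: "(\<lambda>n. v n p) \<longlonglongrightarrow> f p" for p
  proof -
    \<comment> \<open>The slack \<open>1 / (n + 1)\<close> of the near-minimiser becomes a pointwise
      rate through the discriminant.\<close>
    have bound: "(v n p - f p)\<^sup>2 \<le> 1 / real (Suc n) * k p p" for n
    proof (rule quadratic_nonneg_bound)
      show "0 \<le> k p p" by (rule psd_kernel_diag_nonneg[OF k])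
      fix d :: real
      let ?c = "\<lambda>z. (if z \<in> S n then c n z else 0) + (if z = p then d else 0)"
      have "Inf A \<le> q (insert p (S n), ?c)"
        unfolding A_def by (intro cInf_lower bdd[unfolded A_def] imageI) (simp add: S)
      also have "\<dots> = q (S n, c n) + 2 * d * (v n p - f p) + d\<^sup>2 * k p p"
        unfolding q_def prod.case quadratic_add_point[OF S psd_kernel_sym[OF k]] sum_add_point[OF S] v_def
        by (simp add: algebra_simps)
      finally show "0 \<le> 1 / real (Suc n) + 2 * d * (v n p - f p) + d\<^sup>2 * k p p"
        using q[of n] by simp
    qed
    have "(\<lambda>n. 1 / real (Suc n) * k p p) \<longlonglongrightarrow> 0 * k p p"
      by (intro tendsto_mult LIMSEQ_Suc[OF lim_1_over_n] tendsto_const)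
    then have lim: "(\<lambda>n. 1 / real (Suc n) * k p p) \<longlonglongrightarrow> 0" by simp
    have "(\<lambda>n. (v n p - f p)\<^sup>2) \<longlonglongrightarrow> 0"
    proof (rule tendsto_sandwich[OF _ _ tendsto_const lim])
      show "\<forall>\<^sub>F n in sequentially. (v n p - f p)\<^sup>2 \<le> 1 / real (Suc n) * k p p"
        by (intro always_eventually allI bound)
    qed simp
    then have "(\<lambda>n. sqrt ((v n p - f p)\<^sup>2)) \<longlonglongrightarrow> sqrt 0" by (rule tendsto_real_sqrt)
    then have "(\<lambda>n. \<bar>v n p - f p\<bar>) \<longlonglongrightarrow> 0" by simp
    then show ?thesis by (simp add: tendsto_rabs_zero_iff LIM_zero_iff)
  qed
  show ?thesis by (rule borel_measurable_LIMSEQ_real[where u = v, OF v_lim v_meas])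
qed

section \<open>A maximal inequality\<close>

text \<open>Ville's inequality: freezing the product once it has reached \<open>c\<close> keeps its mean at most \<open>1\<close>.\<close>

lemma (in prob_space) ville_prod:
  fixes R :: "nat \<Rightarrow> 'a \<Rightarrow> ennreal" and F :: "nat \<Rightarrow> 'a measure"
  assumes sub: "\<And>t. subalgebra M (F t)" and mono: "\<And>t. subalgebra (F (Suc t)) (F t)"
    and R: "\<And>t. R t \<in> borel_measurable (F (Suc t))"
    and step: "\<And>t u. u \<in> borel_measurable (F t) \<Longrightarrow> (\<integral>\<^sup>+\<omega>. u \<omega> * R t \<omega> \<partial>M) \<le> (\<integral>\<^sup>+\<omega>. u \<omega> \<partial>M)"
  shows "{\<omega>\<in>space M. \<exists>t\<le>n. c \<le> (\<Prod>j<t. R j \<omega>)} \<in> sets M" (is "?E \<in> _")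
    and "c * emeasure M {\<omega>\<in>space M. \<exists>t\<le>n. c \<le> (\<Prod>j<t. R j \<omega>)} \<le> 1"
proof -
  define P where "P t \<omega> = (\<Prod>j<t. R j \<omega>)" for t \<omega>
  define D where "D t \<omega> \<longleftrightarrow> (\<exists>s\<in>{..t}. c \<le> P s \<omega>)" for t \<omega>
  \<comment> \<open>Whether the factor at \<open>j\<close> counts is decided by \<open>D j\<close>,
    which is known in \<open>F j\<close>, before \<open>R j\<close> is revealed.\<close>
  define S where "S t \<omega> = (\<Prod>j<t. if D j \<omega> then 1 else R j \<omega>)" for t \<omega>
  have up: "u \<in> borel_measurable (F t)" if "u \<in> borel_measurable (F s)" "s \<le> t" for u :: "'a \<Rightarrow> ennreal" and s t
    using that(2,1)
  proof (induction rule: dec_induct)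
    case (step n)
    then show ?case by (intro measurable_from_subalg[OF mono]) blast
  qed simp
  have P: "P t \<in> borel_measurable (F t)" for t
    unfolding P_def by (intro borel_measurable_prod_ennreal up[OF R]) auto
  have D: "Measurable.pred (F t) (D t)" for t
    unfolding D_def by (intro pred_intros_finite(4) finite_atMost) (use up[OF P] in measurable)
  have Dup: "Measurable.pred (F t) (D s)" if "s \<le> t" for s t
    using that
  proof (induction rule: dec_induct)
    case (step n)
    show ?case by (rule measurable_from_subalg[OF mono step.IH])
  qed (rule D)
  have S: "S t \<in> borel_measurable (F t)" for t
    unfolding S_def
    by (intro borel_measurable_prod_ennreal measurable_If measurable_const up[OF R] Dup[unfolded pred_def]) auto
  have "(\<integral>\<^sup>+\<omega>. S t \<omega> \<partial>M) \<le> 1" for t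
  proof (induction t)
    case 0
    show ?case by (simp add: S_def emeasure_space_1)
  next
    case (Suc t)
    let ?a = "\<lambda>\<omega>. S t \<omega> * indicator {\<omega>\<in>space (F t). D t \<omega>} \<omega>"
    let ?b = "\<lambda>\<omega>. S t \<omega> * indicator {\<omega>\<in>space (F t). \<not> D t \<omega>} \<omega>"
    have m[measurable]: "?a \<in> borel_measurable (F t)" "?b \<in> borel_measurable (F t)"
      using S[of t] D[of t] by measurable
    have mM: "?a \<in> borel_measurable M" "?b \<in> borel_measurable M" "R t \<in> borel_measurable M"
      by (rule measurable_from_subalg[OF sub m(1)], rule measurable_from_subalg[OF sub m(2)], rule measurable_from_subalg[OF sub R])
    have sp: "space (F t) = space M" using sub by (simp add: subalgebra_def)
    have "(\<integral>\<^sup>+\<omega>. S (Suc t) \<omega> \<partial>M) = (\<integral>\<^sup>+\<omega>. ?a \<omega> + ?b \<omega> * R t \<omega> \<partial>M)"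
      by (intro nn_integral_cong) (auto simp: S_def sp indicator_def)
    also have "\<dots> = (\<integral>\<^sup>+\<omega>. ?a \<omega> \<partial>M) + (\<integral>\<^sup>+\<omega>. ?b \<omega> * R t \<omega> \<partial>M)"
      using mM by (intro nn_integral_add) auto
    also have "\<dots> \<le> (\<integral>\<^sup>+\<omega>. ?a \<omega> \<partial>M) + (\<integral>\<^sup>+\<omega>. ?b \<omega> \<partial>M)"
      by (intro add_left_mono step m)
    also have "\<dots> = (\<integral>\<^sup>+\<omega>. ?a \<omega> + ?b \<omega> \<partial>M)"
      using mM by (intro nn_integral_add[symmetric]) auto
    also have "\<dots> = (\<integral>\<^sup>+\<omega>. S t \<omega> \<partial>M)"
      by (intro nn_integral_cong) (auto simp: sp indicator_def)
    finally show ?case using Suc by simp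
  qed
  note S1 = this
  \<comment> \<open>After the crossing \<open>P\<close> may drop below \<open>c\<close> again, but
    \<open>S\<close> keeps the crossing value. This is why Markov's inequality at the single time
    \<open>n\<close> controls all \<open>t \<le> n\<close>.\<close>
  have inv: "if D t \<omega> then c \<le> S t \<omega> else S t \<omega> = P t \<omega>" for t \<omega>
  proof (induction t)
    case 0
    then show ?case by (auto simp: D_def S_def P_def)
  next
    case (Suc t)
    have "D (Suc t) \<omega> \<longleftrightarrow> D t \<omega> \<or> c \<le> P (Suc t) \<omega>" by (simp add: D_def atMost_Suc disj_commute)
    moreover have "S (Suc t) \<omega> = S t \<omega> * (if D t \<omega> then 1 else R t \<omega>)" by (simp add: S_def)
    moreover have "P (Suc t) \<omega> = P t \<omega> * R t \<omega>" by (simp add: P_def)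
    ultimately show ?case using Suc by auto
  qed
  have SM: "S n \<in> borel_measurable M" by (rule measurable_from_subalg[OF sub S])
  have DM: "{\<omega>\<in>space M. D n \<omega>} \<in> sets M"
    using measurable_from_subalg[OF sub D] by (simp add: pred_def)
  have "c * emeasure M {\<omega>\<in>space M. D n \<omega>} = (\<integral>\<^sup>+\<omega>. c * indicator {\<omega>\<in>space M. D n \<omega>} \<omega> \<partial>M)"
    using DM by (simp add: nn_integral_cmult_indicator)
  also have "\<dots> \<le> (\<integral>\<^sup>+\<omega>. S n \<omega> \<partial>M)"
    using inv[of n] by (intro nn_integral_mono) (auto simp: indicator_def split: if_splits)
  also have "\<dots> \<le> 1" by (rule S1)
  finally show "c * emeasure M ?E \<le> 1" by (simp add: D_def P_def Bex_def)
  have "?E = {\<omega>\<in>space M. D n \<omega>}" unfolding D_def P_def by auto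
  then show "?E \<in> sets M" using DM by simp
qed

section \<open>Sub-Gaussian noise\<close>

text \<open>Gaussian convolution: variance \<open>\<sigma>^2 * (s - 1)\<close> in the mixing mean
  \<open>u\<close> plus \<open>\<sigma>^2\<close> in the noise gives \<open>\<sigma>^2 * s\<close>.
  The exponential in \<open>u\<close> is the density ratio at \<open>\<xi>\<close> of the Gaussians
  with means \<open>u\<close> and 0.\<close>

lemma normal_mixture:
  fixes \<sigma> s m \<xi> :: real
  assumes \<sigma>: "0 < \<sigma>" and s: "1 < s"
  shows "(\<integral>\<^sup>+u. ennreal (normal_density m (\<sigma> * sqrt (s - 1)) u) *
            ennreal (exp (u / \<sigma>\<^sup>2 * \<xi> - u\<^sup>2 / (2 * \<sigma>\<^sup>2))) \<partial>lborel) =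
         ennreal (exp ((\<xi>\<^sup>2 - (\<xi> - m)\<^sup>2 / s) / (2 * \<sigma>\<^sup>2)) / sqrt s)"
proof -
  define v where "v = s - 1"
  have v: "v > 0" and sv: "s = v + 1" using s by (auto simp: v_def)
  \<comment> \<open>\<open>\<tau>\<close> and \<open>m'\<close> are the standard deviation and mean
    of \<open>u\<close> conditional on \<open>\<xi>\<close>; completing the square in
    \<open>u\<close> leaves their density times a constant \<open>C\<close>.\<close>
  define \<tau> where "\<tau> = \<sigma> * sqrt v / sqrt s"
  define m' where "m' = (m + v * \<xi>) / s"
  define C where "C = exp ((\<xi>\<^sup>2 - (\<xi> - m)\<^sup>2 / s) / (2 * \<sigma>\<^sup>2)) / sqrt s"
  have \<tau>: "\<tau> > 0" using \<sigma> v s by (simp add: \<tau>_def)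
  have C: "C \<ge> 0" using s by (simp add: C_def)
  have expo: "- (u - m)\<^sup>2 / (2 * (\<sigma>\<^sup>2 * v)) + (u / \<sigma>\<^sup>2 * \<xi> - u\<^sup>2 / (2 * \<sigma>\<^sup>2)) =
      (\<xi>\<^sup>2 - (\<xi> - m)\<^sup>2 / s) / (2 * \<sigma>\<^sup>2) + - (u - m')\<^sup>2 / (2 * (\<sigma>\<^sup>2 * v / s))" for u
  proof -
    have "- (u - m)\<^sup>2 / v + (2 * u * \<xi> - u\<^sup>2) = \<xi>\<^sup>2 - (\<xi> - m)\<^sup>2 / s - (u - m')\<^sup>2 * s / v"
      using v unfolding m'_def sv by (simp add: divide_simps) (simp add: algebra_simps power2_eq_square)
    then have "(- (u - m)\<^sup>2 / v + (2 * u * \<xi> - u\<^sup>2)) / (2 * \<sigma>\<^sup>2) =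
        (\<xi>\<^sup>2 - (\<xi> - m)\<^sup>2 / s - (u - m')\<^sup>2 * s / v) / (2 * \<sigma>\<^sup>2)" by simp
    then show ?thesis using v s \<sigma> by (simp add: divide_simps) (simp add: algebra_simps)
  qed
  have "normal_density m (\<sigma> * sqrt v) u * exp (u / \<sigma>\<^sup>2 * \<xi> - u\<^sup>2 / (2 * \<sigma>\<^sup>2)) = C * normal_density m' \<tau> u" for u
  proof -
    have "sqrt (2 * pi * (\<sigma> * sqrt v)\<^sup>2) = sqrt s * sqrt (2 * pi * \<tau>\<^sup>2)"
      using v s \<sigma> by (simp add: \<tau>_def power_mult_distrib power_divide real_sqrt_mult[symmetric])
    moreover have "(\<sigma> * sqrt v)\<^sup>2 = \<sigma>\<^sup>2 * v" "\<tau>\<^sup>2 = \<sigma>\<^sup>2 * v / s"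
      using v s by (auto simp: \<tau>_def power_mult_distrib power_divide)
    ultimately show ?thesis
      unfolding normal_density_def C_def
      using expo[of u] by (simp add: exp_add[symmetric] mult.assoc)
  qed
  then have "ennreal (normal_density m (\<sigma> * sqrt (s - 1)) u) * ennreal (exp (u / \<sigma>\<^sup>2 * \<xi> - u\<^sup>2 / (2 * \<sigma>\<^sup>2))) =
      ennreal C * ennreal (normal_density m' \<tau> u)" for u
    using C by (simp add: ennreal_mult[symmetric] v_def)
  then have "(\<integral>\<^sup>+u. ennreal (normal_density m (\<sigma> * sqrt (s - 1)) u) *
      ennreal (exp (u / \<sigma>\<^sup>2 * \<xi> - u\<^sup>2 / (2 * \<sigma>\<^sup>2))) \<partial>lborel) = (\<integral>\<^sup>+u. ennreal C * ennreal (normal_density m' \<tau> u) \<partial>lborel)"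
    by simp
  also have "\<dots> = ennreal C * (\<integral>\<^sup>+u. ennreal (normal_density m' \<tau> u) \<partial>lborel)"
    by (rule nn_integral_cmult) simp
  also have "(\<integral>\<^sup>+u. ennreal (normal_density m' \<tau> u) \<partial>lborel) = 1"
    using prob_space.emeasure_space_1[OF prob_space_normal_density[OF \<tau>]] by (simp add: emeasure_density)
  finally show ?thesis by (simp add: C_def)
qed

text \<open>The left-hand side is a Gaussian mixture of exponentials of linear functions of the noise,
  each of which is controlled by sub-Gaussianity.\<close>

lemma (in prob_space) sub_gaussian_quadratic:
  assumes sg: "sub_gaussian M \<sigma> X" and \<sigma>: "0 < \<sigma>" and s: "1 < s"
  shows "(\<integral>\<^sup>+\<omega>. ennreal (exp (((X \<omega>)\<^sup>2 - (X \<omega> - m)\<^sup>2 / s) / (2 * \<sigma>\<^sup>2)) / sqrt s) \<partial>M) \<le> 1"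
proof -
  have X[measurable]: "X \<in> borel_measurable M" using sg by (simp add: sub_gaussian_def)
  let ?n = "\<lambda>u. ennreal (normal_density m (\<sigma> * sqrt (s - 1)) u)"
  interpret P: pair_sigma_finite M lborel ..
  have mgf: "(\<integral>\<^sup>+\<omega>. ennreal (exp (c * X \<omega>)) \<partial>M) \<le> ennreal (exp (\<sigma>\<^sup>2 * c\<^sup>2 / 2))" for c
    using sg by (subst nn_integral_eq_integral) (auto simp: sub_gaussian_def intro: ennreal_leI)
  \<comment> \<open>At the slope \<open>u / \<sigma>^2\<close> the sub-Gaussian bound is the inverse
    of the factor \<open>exp (- (u^2 / (2 * \<sigma>^2)))\<close>.\<close>
  have inner: "(\<integral>\<^sup>+\<omega>. ennreal (exp (u / \<sigma>\<^sup>2 * X \<omega> - u\<^sup>2 / (2 * \<sigma>\<^sup>2))) \<partial>M) \<le> 1" for u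
  proof -
    have "(\<integral>\<^sup>+\<omega>. ennreal (exp (u / \<sigma>\<^sup>2 * X \<omega> - u\<^sup>2 / (2 * \<sigma>\<^sup>2))) \<partial>M) =
      (\<integral>\<^sup>+\<omega>. ennreal (exp (- (u\<^sup>2 / (2 * \<sigma>\<^sup>2)))) * ennreal (exp (u / \<sigma>\<^sup>2 * X \<omega>)) \<partial>M)"
      by (intro nn_integral_cong) (simp add: ennreal_mult[symmetric] exp_add[symmetric])
    also have "\<dots> = ennreal (exp (- (u\<^sup>2 / (2 * \<sigma>\<^sup>2)))) * (\<integral>\<^sup>+\<omega>. ennreal (exp (u / \<sigma>\<^sup>2 * X \<omega>)) \<partial>M)"
      by (rule nn_integral_cmult) measurable
    also have "\<dots> \<le> ennreal (exp (- (u\<^sup>2 / (2 * \<sigma>\<^sup>2)))) * ennreal (exp (\<sigma>\<^sup>2 * (u / \<sigma>\<^sup>2)\<^sup>2 / 2))"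
      by (intro mult_left_mono mgf) simp
    also have "\<dots> = 1"
      using \<sigma> by (simp add: ennreal_mult[symmetric] exp_add[symmetric] power2_eq_square field_simps)
    finally show ?thesis .
  qed
  have "(\<integral>\<^sup>+\<omega>. ennreal (exp (((X \<omega>)\<^sup>2 - (X \<omega> - m)\<^sup>2 / s) / (2 * \<sigma>\<^sup>2)) / sqrt s) \<partial>M) =
    (\<integral>\<^sup>+\<omega>. (\<integral>\<^sup>+u. ?n u * ennreal (exp (u / \<sigma>\<^sup>2 * X \<omega> - u\<^sup>2 / (2 * \<sigma>\<^sup>2))) \<partial>lborel) \<partial>M)"
    unfolding normal_mixture[OF \<sigma> s] ..
  also have "\<dots> = (\<integral>\<^sup>+u. (\<integral>\<^sup>+\<omega>. ?n u * ennreal (exp (u / \<sigma>\<^sup>2 * X \<omega> - u\<^sup>2 / (2 * \<sigma>\<^sup>2))) \<partial>M) \<partial>lborel)"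
    by (rule P.Fubini'[symmetric]) measurable
  also have "\<dots> = (\<integral>\<^sup>+u. ?n u * (\<integral>\<^sup>+\<omega>. ennreal (exp (u / \<sigma>\<^sup>2 * X \<omega> - u\<^sup>2 / (2 * \<sigma>\<^sup>2))) \<partial>M) \<partial>lborel)"
    by (intro nn_integral_cong nn_integral_cmult) measurable
  also have "\<dots> \<le> (\<integral>\<^sup>+u. ?n u * 1 \<partial>lborel)"
    by (intro nn_integral_mono mult_left_mono inner) simp
  also have "\<dots> = 1"
    using prob_space.emeasure_space_1[OF prob_space_normal_density[of "\<sigma> * sqrt (s - 1)" m]] \<sigma> s
    by (simp add: emeasure_density)
  finally show ?thesis .
qed

text \<open>Two sub-sigma-algebras are encoded as codomains of the identity map. Their independence
  makes the law of the diagonal \<open>(\<omega>, \<omega>)\<close> a product, so the first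
  coordinate can be held fixed while the second is integrated out.\<close>

lemma (in prob_space) indep_var_nn_integral_le:
  fixes u :: "'a \<Rightarrow> ennreal" and r :: "'a \<times> 'a \<Rightarrow> ennreal"
  assumes ind: "indep_var F (\<lambda>\<omega>. \<omega>) G (\<lambda>\<omega>. \<omega>)"
    and u: "u \<in> borel_measurable F" and r: "r \<in> borel_measurable (F \<Otimes>\<^sub>M G)"
    and le: "\<And>\<omega>. \<omega> \<in> space F \<Longrightarrow> (\<integral>\<^sup>+\<omega>'. r (\<omega>, \<omega>') \<partial>M) \<le> 1"
  shows "(\<integral>\<^sup>+\<omega>. u \<omega> * r (\<omega>, \<omega>) \<partial>M) \<le> (\<integral>\<^sup>+\<omega>. u \<omega> \<partial>M)"
proof -
  have rv[measurable]: "(\<lambda>\<omega>. \<omega>) \<in> measurable M F" "(\<lambda>\<omega>. \<omega>) \<in> measurable M G"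
    using ind by (auto dest: indep_var_rv1 indep_var_rv2)
  note u[measurable] r[measurable]
  let ?D = "distr M F (\<lambda>\<omega>. \<omega>)" and ?E = "distr M G (\<lambda>\<omega>. \<omega>)"
  interpret E: prob_space ?E by (rule prob_space_distr) simp
  have eq: "distr M (F \<Otimes>\<^sub>M G) (\<lambda>\<omega>. (\<omega>, \<omega>)) = ?D \<Otimes>\<^sub>M ?E"
    using ind by (simp add: indep_var_distribution_eq)
  have "(\<integral>\<^sup>+\<omega>. u \<omega> * r (\<omega>, \<omega>) \<partial>M) = (\<integral>\<^sup>+p. u (fst p) * r p \<partial>distr M (F \<Otimes>\<^sub>M G) (\<lambda>\<omega>. (\<omega>, \<omega>)))"
    by (subst nn_integral_distr) (auto intro!: nn_integral_cong)
  also have "\<dots> = (\<integral>\<^sup>+\<omega>. (\<integral>\<^sup>+\<omega>'. u \<omega> * r (\<omega>, \<omega>') \<partial>?E) \<partial>?D)"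
    unfolding eq by (subst E.nn_integral_fst[symmetric]) auto
  also have "\<dots> \<le> (\<integral>\<^sup>+\<omega>. u \<omega> \<partial>?D)"
  proof (rule nn_integral_mono)
    fix \<omega> assume "\<omega> \<in> space ?D"
    then have w: "\<omega> \<in> space F" by simp
    then have rw: "(\<lambda>\<omega>'. r (\<omega>, \<omega>')) \<in> borel_measurable G" by measurable
    have "(\<integral>\<^sup>+\<omega>'. u \<omega> * r (\<omega>, \<omega>') \<partial>?E) = u \<omega> * (\<integral>\<^sup>+\<omega>'. r (\<omega>, \<omega>') \<partial>?E)"
      using rw by (intro nn_integral_cmult) simp
    also have "(\<integral>\<^sup>+\<omega>'. r (\<omega>, \<omega>') \<partial>?E) = (\<integral>\<^sup>+\<omega>'. r (\<omega>, \<omega>') \<partial>M)"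
      using rw by (intro nn_integral_distr) auto
    also have "u \<omega> * \<dots> \<le> u \<omega> * 1"
      by (intro mult_left_mono le[OF w]) simp
    finally show "(\<integral>\<^sup>+\<omega>'. u \<omega> * r (\<omega>, \<omega>') \<partial>?E) \<le> u \<omega>" by simp
  qed
  also have "\<dots> = (\<integral>\<^sup>+\<omega>. u \<omega> \<partial>M)"
    by (simp add: nn_integral_distr)
  finally show ?thesis .
qed

text \<open>The sigma-algebra generated by the noise variables with index in \<open>A\<close>. The
  filtration is built from the noise rather than the observations, since independence is assumed for
  the noise.\<close>

definition noise_algebra :: "'w measure \<Rightarrow> (nat \<Rightarrow> nat \<Rightarrow> 'w \<Rightarrow> real) \<Rightarrow> (nat \<times> nat) set \<Rightarrow> 'w measure" where
  "noise_algebra M \<xi> A = vimage_algebra (space M) (\<lambda>\<omega>. \<lambda>(i, s)\<in>A. \<xi> i s \<omega>) (PiM A (\<lambda>_. borel))"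

lemma space_noise_algebra [simp]: "space (noise_algebra M \<xi> A) = space M"
  by (simp add: noise_algebra_def)

lemma sets_noise_algebra:
  "sets (noise_algebra M \<xi> A) =
    {(\<lambda>\<omega>. \<lambda>(i, s)\<in>A. \<xi> i s \<omega>) -` S \<inter> space M | S. S \<in> sets (PiM A (\<lambda>_. borel))}"
  unfolding noise_algebra_def by (rule sets_vimage_algebra2) (auto simp: space_PiM)

lemma noise_algebra_measurable:
  assumes "(i, s) \<in> A"
  shows "\<xi> i s \<in> borel_measurable (noise_algebra M \<xi> A)"
proof -
  have "(\<lambda>\<omega>. \<lambda>(i, s)\<in>A. \<xi> i s \<omega>) \<in> measurable (noise_algebra M \<xi> A) (PiM A (\<lambda>_. borel))"
    unfolding noise_algebra_def by (rule measurable_vimage_algebra1) (auto simp: space_PiM)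
  from measurable_compose[OF this measurable_component_singleton[OF assms]] show ?thesis
    using assms by simp
qed

lemma subalgebra_noise_algebra:
  assumes F: "space F = space M" and m: "\<And>i s. (i, s) \<in> A \<Longrightarrow> \<xi> i s \<in> borel_measurable F"
  shows "subalgebra F (noise_algebra M \<xi> A)"
proof -
  have "(\<lambda>\<omega>. \<lambda>(i, s)\<in>A. \<xi> i s \<omega>) \<in> measurable F (PiM A (\<lambda>_. borel))"
    using m by (intro measurable_restrict) auto
  from measurable_sets[OF this] show ?thesis
    using F by (auto simp: subalgebra_def sets_noise_algebra)
qed

lemma (in prob_space) indep_noise_algebra:
  assumes noise: "iid_sub_gaussian_noise M N \<sigma> \<xi>"
    and AB: "A \<inter> B = {}" "A \<subseteq> {0..N} \<times> {1..}" "B \<subseteq> {0..N} \<times> {1..}"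
  shows "indep_var (noise_algebra M \<xi> A) (\<lambda>\<omega>. \<omega>) (noise_algebra M \<xi> B) (\<lambda>\<omega>. \<omega>)"
proof -
  have ind: "indep_vars (\<lambda>_. borel) (\<lambda>(i, t). \<xi> i t) ({0..N} \<times> {1..})"
    using noise by (simp add: iid_sub_gaussian_noise_def)
  have eq: "(\<lambda>\<omega>. restrict (\<lambda>p. (case p of (i, t) \<Rightarrow> \<xi> i t) \<omega>) A) = (\<lambda>\<omega>. \<lambda>(i, s)\<in>A. \<xi> i s \<omega>)" for A
    by (auto simp: fun_eq_iff restrict_def)
  note ind2 = indep_var_restrict[OF ind AB, unfolded eq]
  \<comment> \<open>Independence is tested on generated sigma-algebras; the identity into
    \<open>noise_algebra\<close> generates the same one as the tuple of noise variables.\<close>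
  have gen: "sigma_sets (space M) {(\<lambda>\<omega>. \<omega>) -` S \<inter> space M | S. S \<in> sets (noise_algebra M \<xi> A)} =
      sigma_sets (space M) {(\<lambda>\<omega>. \<lambda>(i, s)\<in>A. \<xi> i s \<omega>) -` S \<inter> space M | S. S \<in> sets (PiM A (\<lambda>_. borel))}" for A
  proof -
    have "{(\<lambda>\<omega>. \<omega>) -` S \<inter> space M | S. S \<in> sets (noise_algebra M \<xi> A)} = sets (noise_algebra M \<xi> A)"
    proof -
      have "S \<inter> space M = S" if "S \<in> sets (noise_algebra M \<xi> A)" for S
        using sets.sets_into_space[OF that] by auto
      then show ?thesis by auto
    qed
    then show ?thesis unfolding sets_noise_algebra by simp
  qed
  have rv: "(\<lambda>\<omega>. \<omega>) \<in> measurable M (noise_algebra M \<xi> A)"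
    if "(\<lambda>\<omega>. \<lambda>(i, s)\<in>A. \<xi> i s \<omega>) \<in> measurable M (PiM A (\<lambda>_. borel))" for A
    unfolding noise_algebra_def by (rule measurable_vimage_algebra2[OF _ that]) auto
  show ?thesis
    using ind2 unfolding indep_var_eq gen by (auto intro: rv)
qed

section \<open>The self-normalised bound\<close>

lemma rcov_measurable:
  fixes k :: "'a::second_countable_topology \<Rightarrow> 'a \<Rightarrow> real"
  assumes k: "(\<lambda>(z, z'). k z z') \<in> borel_measurable borel"
    and x: "\<And>j. 1 \<le> j \<Longrightarrow> j \<le> t \<Longrightarrow> x j \<in> borel_measurable F"
    and uv: "u \<in> borel_measurable F" "v \<in> borel_measurable F"
  shows "(\<lambda>\<omega>. rcov k l (\<lambda>s. x s \<omega>) t (u \<omega>) (v \<omega>)) \<in> borel_measurable F"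
  using x uv
proof (induction t arbitrary: u v)
  case 0
  have "(\<lambda>\<omega>. (u \<omega>, v \<omega>)) \<in> borel_measurable F"
    using 0 by (intro borel_measurable_Pair)
  from measurable_compose[OF this k] show ?case by simp
next
  case (Suc t)
  have x: "x (Suc t) \<in> borel_measurable F" using Suc.prems(1) by simp
  have "(\<lambda>\<omega>. rcov k l (\<lambda>s. x s \<omega>) t (u \<omega>) (v \<omega>)) \<in> borel_measurable F"
    if "u \<in> borel_measurable F" "v \<in> borel_measurable F" for u v
    using that by (intro Suc.IH) (auto intro: Suc.prems(1))
  note this[measurable] and x[measurable] and Suc.prems(2,3)[measurable]
  show ?case unfolding rcov.simps by measurable
qed

lemma rmean_measurable:
  fixes k :: "'a::second_countable_topology \<Rightarrow> 'a \<Rightarrow> real"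
  assumes k: "(\<lambda>(z, z'). k z z') \<in> borel_measurable borel"
    and x: "\<And>j. 1 \<le> j \<Longrightarrow> j \<le> t \<Longrightarrow> x j \<in> borel_measurable F"
    and y: "\<And>j. 1 \<le> j \<Longrightarrow> j \<le> t \<Longrightarrow> y j \<in> borel_measurable F"
    and u: "u \<in> borel_measurable F"
  shows "(\<lambda>\<omega>. rmean k l (\<lambda>s. x s \<omega>) (\<lambda>s. y s \<omega>) t (u \<omega>)) \<in> borel_measurable F"
  using x y u
proof (induction t arbitrary: u)
  case (Suc t)
  have x: "x (Suc t) \<in> borel_measurable F" and y: "y (Suc t) \<in> borel_measurable F"
    using Suc.prems(1,2) by simp_all
  have "(\<lambda>\<omega>. rmean k l (\<lambda>s. x s \<omega>) (\<lambda>s. y s \<omega>) t (u \<omega>)) \<in> borel_measurable F"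
    if "u \<in> borel_measurable F" for u
    using that by (intro Suc.IH) (auto intro: Suc.prems(1,2))
  moreover have "(\<lambda>\<omega>. rcov k l (\<lambda>s. x s \<omega>) t (u \<omega>) (v \<omega>)) \<in> borel_measurable F"
    if "u \<in> borel_measurable F" "v \<in> borel_measurable F" for u v
    using that by (intro rcov_measurable k) (auto intro: Suc.prems(1))
  ultimately show ?case using x y Suc.prems(3)
    unfolding rmean.simps by (intro borel_measurable_add borel_measurable_divide borel_measurable_times borel_measurable_diff borel_measurable_const) auto
qed simp

text \<open>The regularisation costs at most 2 in the log-determinant over the whole horizon; half
  of this is the constant 1 in the confidence radius.\<close>

lemma reg_power_le:
  assumes "1 \<le> T" "t \<le> T"
  shows "real t * ln (reg T) \<le> 2"
proof -
  have "ln (reg T) \<le> 2 / real T"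
    unfolding reg_def by (rule ln_add_one_self_le_self) simp
  moreover have "0 \<le> ln (reg T)" using reg_ge_one[of T] by simp
  ultimately have "real t * ln (reg T) \<le> real T * (2 / real T)"
    using assms by (intro mult_mono) auto
  then show ?thesis using assms by simp
qed

lemma sum_ln_reg_rcov:
  assumes k: "psd_kernel k" and T: "1 \<le> T" "t \<le> T"
  shows "(\<Sum>j<t. ln (reg T + rcov k (reg T) x j (x (Suc j)) (x (Suc j)))) \<le> 2 * (1 + info_gain k (reg T) x t)"
proof -
  let ?l = "reg T" and ?c = "\<lambda>j. rcov k (reg T) x j (x (Suc j)) (x (Suc j))"
  have l: "?l > 0" using reg_ge_one[of T] by simp
  have "ln (?l + ?c j) = ln ?l + ln (1 + ?c j / ?l)" for j
  proof -
    have "0 < 1 + ?c j / ?l" using rcov_nonneg[OF k reg_ge_one[of T], where x=x and t=j] l by (simp add: add_pos_nonneg)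
    then have "ln (?l * (1 + ?c j / ?l)) = ln ?l + ln (1 + ?c j / ?l)" using l by (intro ln_mult_pos)
    moreover have "?l * (1 + ?c j / ?l) = ?l + ?c j" using l by (simp add: field_simps)
    ultimately show ?thesis by simp
  qed
  then have "(\<Sum>j<t. ln (?l + ?c j)) = real t * ln ?l + 2 * info_gain k ?l x t"
    by (simp add: sum.distrib info_gain_def)
  then show ?thesis using reg_power_le[OF T] by simp
qed

text \<open>The exceptional event serves all steps at once. The bound uses the gain along the path,
  since the queries need not lie in the candidate set at every \<open>\<omega>\<close>.\<close>

lemma (in prob_space) energy_bound:
  fixes k :: "'b::second_countable_topology \<Rightarrow> 'b \<Rightarrow> real" and T :: nat
  assumes noise: "iid_sub_gaussian_noise M N \<sigma> \<xi>" and i: "i \<le> N" and \<sigma>: "0 < \<sigma>" and c: "0 < c"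
    and k: "psd_kernel k" and k_meas: "(\<lambda>(z, z'). k z z') \<in> borel_measurable borel"
    and f: "f \<in> borel_measurable borel" and T: "1 \<le> T"
    and adapted: "\<And>t. t < T \<Longrightarrow> x (Suc t) \<in> borel_measurable (noise_algebra M \<xi> ({0..N} \<times> {1..t}))"
  shows "\<exists>E\<in>sets M. measure M E \<le> 1 / c \<and> (\<forall>\<omega>\<in>space M - E. \<forall>t\<le>T.
    energy k (reg T) (\<lambda>s. x s \<omega>) (\<lambda>s. f (x s \<omega>) + \<xi> i s \<omega>) f t \<le>
      2 * \<sigma>\<^sup>2 * (info_gain k (reg T) (\<lambda>s. x s \<omega>) t + 1 + ln c))"
proof -
  define F where "F t = noise_algebra M \<xi> ({0..N} \<times> {1..t})" for t
  define G where "G t = noise_algebra M \<xi> {(i, Suc t)}" for t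
  define y where "y s \<omega> = f (x s \<omega>) + \<xi> i s \<omega>" for s \<omega>
  define s where "s t \<omega> = reg T + rcov k (reg T) (\<lambda>s. x s \<omega>) t (x (Suc t) \<omega>) (x (Suc t) \<omega>)" for t \<omega>
  define m where "m t \<omega> = rmean k (reg T) (\<lambda>s. x s \<omega>) (\<lambda>s. y s \<omega>) t (x (Suc t) \<omega>) - f (x (Suc t) \<omega>)" for t \<omega>
  \<comment> \<open>Past and fresh noise are separated: \<open>m t\<close> and \<open>s t\<close>
    depend on the past \<open>\<omega>\<close>, the noise of step \<open>Suc t\<close> is read at
    \<open>\<omega>'\<close>.\<close>
  define r where "r t = (\<lambda>(\<omega>, \<omega>').
    ennreal (exp (((\<xi> i (Suc t) \<omega>')\<^sup>2 - (\<xi> i (Suc t) \<omega>' - m t \<omega>)\<^sup>2 / s t \<omega>) / (2 * \<sigma>\<^sup>2)) / sqrt (s t \<omega>)))" for t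
  \<comment> \<open>Queries are controlled only up to the horizon, whereas Ville's inequality wants
    factors at all times.\<close>
  define R where "R t \<omega> = (if t < T then r t (\<omega>, \<omega>) else 1)" for t \<omega>
  define e where "e t \<omega> = energy k (reg T) (\<lambda>s. x s \<omega>) (\<lambda>s. y s \<omega>) f t" for t \<omega>
  \<comment> \<open>Strictness comes from \<open>2 / T > 0\<close>; it makes the variance of the
    mixing Gaussian positive.\<close>
  have s_gt: "1 < s t \<omega>" for t \<omega>
    using rcov_nonneg[OF k reg_ge_one[of T], where x="\<lambda>s. x s \<omega>" and t=t and z="x (Suc t) \<omega>"] T
    by (simp add: s_def reg_def add_pos_nonneg)
  have \<xi>_meas: "\<xi> j t \<in> borel_measurable M" if "j \<le> N" "1 \<le> t" for j t
    using noise that by (auto simp: iid_sub_gaussian_noise_def sub_gaussian_def)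
  have \<xi>_F: "\<xi> i j \<in> borel_measurable (F t)" if "1 \<le> j" "j \<le> t" for j t
    using that i unfolding F_def by (intro noise_algebra_measurable) simp
  have sub: "subalgebra M (F t)" for t
    unfolding F_def by (rule subalgebra_noise_algebra) (auto intro: \<xi>_meas)
  have subF: "subalgebra (F t') (F t)" if "t \<le> t'" for t t'
    unfolding F_def
    by (rule subalgebra_noise_algebra) (use that in \<open>auto intro!: noise_algebra_measurable\<close>)
  \<comment> \<open>Queries are predictable: \<open>x (Suc t)\<close> is known in
    \<open>F t\<close>, before the noise of its own step.\<close>
  have x_F: "x j \<in> borel_measurable (F t)" if j: "1 \<le> j" "j \<le> Suc t" "j \<le> T" for j t
  proof -
    obtain j' where j': "j = Suc j'" using j by (cases j) auto
    have "x j \<in> borel_measurable (F j')" using adapted[of j'] j unfolding j' F_def by simp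
    then show ?thesis using j by (intro measurable_from_subalg[OF subF[of j' t]]) (auto simp: j')
  qed
  have y_F: "y j \<in> borel_measurable (F t)" if "1 \<le> j" "j \<le> t" "j \<le> T" for j t
    unfolding y_def using that by (intro borel_measurable_add measurable_compose[OF x_F f] \<xi>_F) auto
  have s_F: "s t \<in> borel_measurable (F t)" if "t < T" for t
    unfolding s_def using that by (intro borel_measurable_add borel_measurable_const rcov_measurable k_meas x_F) auto
  have m_F: "m t \<in> borel_measurable (F t)" if "t < T" for t
    unfolding m_def using that
    by (intro borel_measurable_diff measurable_compose[OF x_F f] rmean_measurable k_meas x_F y_F) auto
  have \<xi>_G: "\<xi> i (Suc t) \<in> borel_measurable (G t)" for t
    unfolding G_def by (rule noise_algebra_measurable) simp
  have r_FG: "r t \<in> borel_measurable (F t \<Otimes>\<^sub>M G t)" if t: "t < T" for t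
  proof -
    note s_F[OF t, measurable] m_F[OF t, measurable] \<xi>_G[measurable]
    show ?thesis unfolding r_def by measurable
  qed
  have R_F: "R t \<in> borel_measurable (F (Suc t))" for t
  proof (cases "t < T")
    case True
    have s1[measurable]: "s t \<in> borel_measurable (F (Suc t))" and m1[measurable]: "m t \<in> borel_measurable (F (Suc t))"
      using s_F[OF True] m_F[OF True] measurable_from_subalg[OF subF[of t "Suc t"]] by simp_all
    have \<xi>1[measurable]: "\<xi> i (Suc t) \<in> borel_measurable (F (Suc t))" by (rule \<xi>_F) auto
    show ?thesis using True unfolding R_def r_def by simp
  next
    case False
    then have "R t = (\<lambda>_. 1)" by (simp add: R_def fun_eq_iff)
    then show ?thesis by simp
  qed
  have step: "(\<integral>\<^sup>+\<omega>. u \<omega> * R t \<omega> \<partial>M) \<le> (\<integral>\<^sup>+\<omega>. u \<omega> \<partial>M)" if u: "u \<in> borel_measurable (F t)" for u t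
  proof (cases "t < T")
    case True
    have "indep_var (F t) (\<lambda>\<omega>. \<omega>) (G t) (\<lambda>\<omega>. \<omega>)"
      unfolding F_def G_def by (rule indep_noise_algebra[OF noise]) (use i in auto)
    moreover have "(\<integral>\<^sup>+\<omega>'. r t (\<omega>, \<omega>') \<partial>M) \<le> 1" for \<omega>
      unfolding r_def prod.case using noise i
      by (intro sub_gaussian_quadratic \<sigma> s_gt) (auto simp: iid_sub_gaussian_noise_def)
    ultimately have "(\<integral>\<^sup>+\<omega>. u \<omega> * r t (\<omega>, \<omega>) \<partial>M) \<le> (\<integral>\<^sup>+\<omega>. u \<omega> \<partial>M)"
      using u r_FG[OF True] by (intro indep_var_nn_integral_le) auto
    then show ?thesis using True by (simp add: R_def)
  qed (simp add: R_def)
  define E where "E = {\<omega>\<in>space M. \<exists>t\<le>T. ennreal c \<le> (\<Prod>j<t. R j \<omega>)}"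
  have subS: "subalgebra (F (Suc t)) (F t)" for t by (rule subF) simp
  note ville = ville_prod[where F = F and R = R, OF sub subS R_F step]
  have E: "E \<in> sets M" unfolding E_def by (rule ville(1))
  have Ec: "ennreal c * emeasure M E \<le> 1" unfolding E_def by (rule ville(2))
  have "ennreal (c * measure M E) \<le> ennreal 1"
    using Ec c by (simp add: emeasure_eq_measure ennreal_mult)
  then have "c * measure M E \<le> 1" using c by (simp add: ennreal_le_iff2)
  then have "measure M E \<le> 1 / c" using c by (simp add: field_simps)
  moreover have "e t \<omega> \<le> 2 * \<sigma>\<^sup>2 * (info_gain k (reg T) (\<lambda>s. x s \<omega>) t + 1 + ln c)"
    if \<omega>: "\<omega> \<in> space M - E" and t: "t \<le> T" for \<omega> t
  proof -
    \<comment> \<open>The exponents add up to the energy, and the square roots become half the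
      log-determinant.\<close>
    have R_prod: "(\<Prod>j<t. R j \<omega>) = ennreal (exp (e t \<omega> / (2 * \<sigma>\<^sup>2) - (\<Sum>j<t. ln (s j \<omega>)) / 2))"
      using t
    proof (induction t)
      case (Suc t)
      have "exp (a / b) / sqrt (s t \<omega>) = exp (a / b - ln (s t \<omega>) / 2)" for a b
        using s_gt[of t \<omega>] by (simp add: exp_diff ln_sqrt[symmetric])
      then have "R t \<omega> = ennreal (exp (((y (Suc t) \<omega> - f (x (Suc t) \<omega>))\<^sup>2 -
          (y (Suc t) \<omega> - rmean k (reg T) (\<lambda>s. x s \<omega>) (\<lambda>s. y s \<omega>) t (x (Suc t) \<omega>))\<^sup>2 / s t \<omega>) / (2 * \<sigma>\<^sup>2) - ln (s t \<omega>) / 2))"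
        using Suc.prems by (simp add: R_def r_def m_def y_def algebra_simps)
      moreover have "e (Suc t) \<omega> = e t \<omega> + ((y (Suc t) \<omega> - f (x (Suc t) \<omega>))\<^sup>2 -
          (y (Suc t) \<omega> - rmean k (reg T) (\<lambda>s. x s \<omega>) (\<lambda>s. y s \<omega>) t (x (Suc t) \<omega>))\<^sup>2 / s t \<omega>)"
        by (simp add: e_def s_def)
      ultimately show ?case using Suc
        by (simp add: ennreal_mult[symmetric] exp_add[symmetric] add_divide_distrib)
    qed (simp add: e_def)
    have "\<not> ennreal c \<le> (\<Prod>j<t. R j \<omega>)" using \<omega> t by (auto simp: E_def)
    then have "exp (e t \<omega> / (2 * \<sigma>\<^sup>2) - (\<Sum>j<t. ln (s j \<omega>)) / 2) < c"
      unfolding R_prod using c by (simp add: ennreal_le_iff not_le)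
    then have "e t \<omega> / (2 * \<sigma>\<^sup>2) - (\<Sum>j<t. ln (s j \<omega>)) / 2 < ln c"
      using c by (metis exp_gt_zero ln_exp ln_less_cancel_iff)
    moreover have "(\<Sum>j<t. ln (s j \<omega>)) \<le> 2 * (1 + info_gain k (reg T) (\<lambda>s. x s \<omega>) t)"
      unfolding s_def by (rule sum_ln_reg_rcov[OF k T t])
    ultimately have "e t \<omega> / (2 * \<sigma>\<^sup>2) \<le> info_gain k (reg T) (\<lambda>s. x s \<omega>) t + 1 + ln c" by simp
    then show ?thesis using \<sigma> by (simp add: pos_divide_le_eq mult.commute)
  qed
  ultimately show ?thesis using E unfolding e_def y_def by blast
qed

section \<open>Information gain\<close>

lemma rcov_cong:
  assumes "\<And>a. a \<in> {1..t} \<Longrightarrow> x a = x' a"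
  shows "rcov k l x t = rcov k l x' t"
  using assms by (induction t) (simp_all add: fun_eq_iff)

lemma info_gain_cong:
  assumes "\<And>a. a \<in> {1..t} \<Longrightarrow> x a = x' a"
  shows "info_gain k l x t = info_gain k l x' t"
proof -
  have "rcov k l x j (x (Suc j)) (x (Suc j)) = rcov k l x' j (x' (Suc j)) (x' (Suc j))" if "j < t" for j
    using assms that by (subst rcov_cong[of j x x']) auto
  then show ?thesis unfolding info_gain_def by (intro arg_cong[where f = "\<lambda>u. u / 2"] sum.cong) simp_all
qed

lemma max_info_gain_eq:
  assumes "psd_kernel k"
  shows "max_info_gain k X T t = (SUP x\<in>{x. \<forall>a\<in>{1..t}. x a \<in> X}. info_gain k (reg T) x t)"
  unfolding max_info_gain_def ln_det_eq_info_gain[OF assms] ..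

text \<open>The diagonal bound keeps the ratio of posterior variance to \<lambda> in the unit
  interval. Hence the supremum of the gains is finite, and variances are comparable with
  logarithms.\<close>

locale bounded_kernel =
  fixes k :: "'a \<Rightarrow> 'a \<Rightarrow> real" and X :: "'a set"
  assumes psd: "psd_kernel k" and le_one: "z \<in> X \<Longrightarrow> k z z \<le> 1" and nonempty: "X \<noteq> {}"
begin

lemma ratio_nonneg: "0 \<le> rcov k (reg T) x j z z / reg T"
  using rcov_nonneg[OF psd reg_ge_one[of T], of x j z] reg_ge_one[of T] by simp

lemma ratio_le_one:
  assumes "z \<in> X"
  shows "rcov k (reg T) x j z z / reg T \<le> 1"
  using rcov_le[OF psd reg_ge_one[of T], of x j z] le_one[OF assms] reg_ge_one[of T] by simp

lemma info_gain_term_nonneg: "0 \<le> ln (1 + rcov k (reg T) x j z z / reg T)"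
  using ratio_nonneg[of T x j z] by (intro ln_ge_zero) simp

lemma info_gain_bound:
  assumes "\<forall>a\<in>{1..t}. x a \<in> X"
  shows "info_gain k (reg T) x t \<le> real t * ln 2 / 2"
proof -
  have "ln (1 + rcov k (reg T) x j (x (Suc j)) (x (Suc j)) / reg T) \<le> ln 2" if "j < t" for j
  proof -
    have "x (Suc j) \<in> X" using assms that by simp
    from ratio_le_one[OF this, of T x j] ratio_nonneg[of T x j "x (Suc j)"]
    show ?thesis by (subst ln_le_cancel_iff) simp_all
  qed
  then have "(\<Sum>j<t. ln (1 + rcov k (reg T) x j (x (Suc j)) (x (Suc j)) / reg T)) \<le> (\<Sum>j<t. ln 2)"
    by (intro sum_mono) simp
  then show ?thesis by (simp add: info_gain_def)
qed

lemma info_gain_le_max: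
  assumes "\<forall>a\<in>{1..t}. x a \<in> X"
  shows "info_gain k (reg T) x t \<le> max_info_gain k X T t"
  unfolding max_info_gain_eq[OF psd]
proof (rule cSUP_upper)
  show "bdd_above ((\<lambda>x. info_gain k (reg T) x t) ` {x. \<forall>a\<in>{1..t}. x a \<in> X})"
    by (rule bdd_aboveI2[where M = "real t * ln 2 / 2"]) (use info_gain_bound in blast)
qed (use assms in simp)

lemma info_gain_mono:
  assumes "t \<le> t'"
  shows "info_gain k (reg T) x t \<le> info_gain k (reg T) x t'"
  unfolding info_gain_def
  by (intro divide_right_mono sum_mono2) (use assms info_gain_term_nonneg in auto)

lemma max_info_gain_mono:
  assumes "t \<le> t'"
  shows "max_info_gain k X T t \<le> max_info_gain k X T t'"
proof -
  obtain p where p: "p \<in> X" using nonempty by auto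
  show ?thesis unfolding max_info_gain_eq[OF psd, of X T t]
  proof (rule cSUP_least)
    show "{x. \<forall>a\<in>{1..t}. x a \<in> X} \<noteq> {}" using p by auto
  next
    fix x assume x: "x \<in> {x. \<forall>a\<in>{1..t}. x a \<in> X}"
    \<comment> \<open>The entries of \<open>x\<close> beyond \<open>t\<close> may lie outside
      \<open>X\<close>; padding with \<open>p\<close> gives an admissible longer tuple.\<close>
    define x' where "x' a = (if a \<in> {1..t} then x a else p)" for a
    have "info_gain k (reg T) x t = info_gain k (reg T) x' t"
      by (rule info_gain_cong) (simp add: x'_def)
    also have "\<dots> \<le> info_gain k (reg T) x' t'" by (rule info_gain_mono[OF assms])
    also have "\<dots> \<le> max_info_gain k X T t'"
      by (rule info_gain_le_max) (use x p in \<open>auto simp: x'_def\<close>)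
    finally show "info_gain k (reg T) x t \<le> max_info_gain k X T t'" .
  qed
qed

lemma max_info_gain_nonneg: "0 \<le> max_info_gain k X T t"
proof -
  obtain p where p: "p \<in> X" using nonempty by auto
  have "0 \<le> info_gain k (reg T) (\<lambda>_. p) t"
    unfolding info_gain_def by (intro divide_nonneg_nonneg sum_nonneg info_gain_term_nonneg) simp
  also have "\<dots> \<le> max_info_gain k X T t" by (rule info_gain_le_max) (use p in simp)
  finally show ?thesis .
qed

text \<open>On the unit interval \<open>u / 2 \<le> u / (1 + u) \<le> ln (1 + u)\<close>. The 4 is
  this factor 2 times the 2 that undoes the half in \<open>info_gain\<close>.\<close>

lemma sum_rcov_le:
  assumes x: "\<forall>a\<in>{1..t}. x a \<in> X"
  shows "(\<Sum>j<t. rcov k (reg T) x j (x (Suc j)) (x (Suc j))) \<le> 4 * reg T * max_info_gain k X T t"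
proof -
  have l: "reg T > 0" using reg_ge_one[of T] by simp
  have "rcov k (reg T) x j (x (Suc j)) (x (Suc j)) \<le>
      2 * reg T * ln (1 + rcov k (reg T) x j (x (Suc j)) (x (Suc j)) / reg T)" if "j < t" for j
  proof -
    define u where "u = rcov k (reg T) x j (x (Suc j)) (x (Suc j)) / reg T"
    have "x (Suc j) \<in> X" using x that by simp
    then have u: "0 \<le> u" "u \<le> 1" using ratio_le_one ratio_nonneg by (auto simp: u_def)
    have "u / 2 \<le> u / (1 + u)" using u by (simp add: field_simps mult_left_le)
    also have "\<dots> \<le> ln (1 + u)"
    proof -
      have "ln (1 / (1 + u)) \<le> 1 / (1 + u) - 1" using u by (intro ln_le_minus_one) simp
      then show ?thesis using u by (simp add: ln_div field_simps)
    qed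
    finally have "reg T * u \<le> reg T * (2 * ln (1 + u))" using l by (intro mult_left_mono) simp_all
    then show ?thesis using l by (simp add: u_def)
  qed
  then have "(\<Sum>j<t. rcov k (reg T) x j (x (Suc j)) (x (Suc j))) \<le>
      (\<Sum>j<t. 2 * reg T * ln (1 + rcov k (reg T) x j (x (Suc j)) (x (Suc j)) / reg T))"
    by (intro sum_mono) simp
  also have "\<dots> = 4 * reg T * info_gain k (reg T) x t"
    unfolding info_gain_def sum_distrib_left[symmetric] by simp
  also have "\<dots> \<le> 4 * reg T * max_info_gain k X T t"
    using l by (intro mult_left_mono info_gain_le_max x) simp
  finally show ?thesis .
qed

lemma sum_sd_le:
  assumes x: "\<forall>a\<in>{1..T}. x a \<in> X" and T: "1 \<le> T"
  shows "(\<Sum>t=1..T. post_sd k T x (t - 1) (x t)) \<le> 2 * sqrt ((real T + 2) * max_info_gain k X T T)"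
proof -
  define c where "c j = rcov k (reg T) x j (x (Suc j)) (x (Suc j))" for j
  have c: "0 \<le> c j" for j unfolding c_def by (rule rcov_nonneg[OF psd reg_ge_one])
  have "(\<Sum>t=1..T. post_sd k T x (t - 1) (x t)) = (\<Sum>j<T. sqrt (c j))"
    by (rule sum.reindex_bij_witness[of _ Suc "\<lambda>t. t - 1"])
      (auto simp: post_sd_def post_cov_eq_rcov[OF psd] c_def)
  also have "\<dots> \<le> sqrt (real T * (\<Sum>j<T. c j))"
  proof (rule real_le_rsqrt)
    have "(\<Sum>j<T. 1 * sqrt (c j))\<^sup>2 \<le> (\<Sum>j<T. 1\<^sup>2) * (\<Sum>j<T. (sqrt (c j))\<^sup>2)"
      by (rule Cauchy_Schwarz_ineq_sum)
    then show "(\<Sum>j<T. sqrt (c j))\<^sup>2 \<le> real T * (\<Sum>j<T. c j)" using c by simp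
  qed
  also have "\<dots> \<le> sqrt (real T * (4 * reg T * max_info_gain k X T T))"
    unfolding c_def by (intro real_sqrt_le_mono mult_left_mono sum_rcov_le x) simp
  \<comment> \<open>\<open>T * reg T = T + 2\<close> is the origin of the \<open>T + 2\<close> in
    the theorem.\<close>
  also have "real T * (4 * reg T * max_info_gain k X T T) = 2\<^sup>2 * ((real T + 2) * max_info_gain k X T T)"
    using T by (simp add: reg_def field_simps)
  also have "sqrt \<dots> = 2 * sqrt ((real T + 2) * max_info_gain k X T T)"
    by (simp only: real_sqrt_mult real_sqrt_abs)
  finally show ?thesis .
qed

lemma conf_radius_mono:
  assumes "0 \<le> \<sigma>" "t \<le> t'"
  shows "conf_radius k X b \<sigma> N \<delta> T t \<le> conf_radius k X b \<sigma> N \<delta> T t'"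
  unfolding conf_radius_def using assms max_info_gain_mono[of "t - 1" "t' - 1" T]
  by (intro add_left_mono mult_left_mono real_sqrt_le_mono) auto

lemma conf_radius_nonneg:
  assumes "0 \<le> b" "0 \<le> \<sigma>" "0 < \<delta>" "\<delta> \<le> 1"
  shows "0 \<le> conf_radius k X b \<sigma> N \<delta> T t"
proof -
  have "0 \<le> ln ((real N + 1) / \<delta>)" using assms by (intro ln_ge_zero) simp
  then show ?thesis
    unfolding conf_radius_def using assms max_info_gain_nonneg[of T "t - 1"] by simp
qed

text \<open>A sum of squares of nonnegative numbers is at most the square of their sum, which gives
  the additive shape of the radius. The radius at \<open>Suc t\<close> contains the gain after
  \<open>t\<close> queries, matching the posterior after \<open>t\<close> observations.\<close>

lemma conf_bound:
  assumes dom: "dominated k (b0\<^sup>2) (\<lambda>z. - f z)" and b: "0 \<le> b0" "b0 \<le> b"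
    and \<sigma>: "0 < \<sigma>" and \<delta>: "0 < \<delta>" "\<delta> < 1"
    and x: "\<forall>a\<in>{1..t}. x a \<in> X"
    and energy: "energy k (reg T) x y f t \<le> 2 * \<sigma>\<^sup>2 * (info_gain k (reg T) x t + 1 + ln ((real N + 1) / \<delta>))"
  shows "\<bar>post_mean k T x y t z - f z\<bar> \<le> conf_radius k X b \<sigma> N \<delta> T (Suc t) * post_sd k T x t z"
proof -
  define w where "w = 2 * (max_info_gain k X T t + 1 + ln ((real N + 1) / \<delta>))"
  have "0 \<le> ln ((real N + 1) / \<delta>)" using \<delta> by (intro ln_ge_zero) simp
  then have w: "0 \<le> w" using max_info_gain_nonneg[of T t] by (simp add: w_def)
  have c: "0 \<le> rcov k (reg T) x t z z" by (rule rcov_nonneg[OF psd reg_ge_one])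
  have "(rmean k (reg T) x y t z - f z)\<^sup>2 \<le> (b0\<^sup>2 + energy k (reg T) x y f t) * rcov k (reg T) x t z z"
    by (rule dominated_bound[OF rmean_dominated[OF psd reg_ge_one dom]])
  also have "\<dots> \<le> (b + \<sigma> * sqrt w)\<^sup>2 * rcov k (reg T) x t z z"
  proof (intro mult_right_mono c)
    have "energy k (reg T) x y f t \<le> \<sigma>\<^sup>2 * (2 * (info_gain k (reg T) x t + 1 + ln ((real N + 1) / \<delta>)))"
      using energy by (simp only: mult_ac)
    also have "\<dots> \<le> \<sigma>\<^sup>2 * w"
      unfolding w_def using info_gain_le_max[OF x, of T] by (intro mult_left_mono) simp_all
    finally have "b0\<^sup>2 + energy k (reg T) x y f t \<le> b\<^sup>2 + (\<sigma> * sqrt w)\<^sup>2"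
      using power_mono[OF b(2,1), of 2] w by (simp add: power_mult_distrib)
    also have "\<dots> \<le> (b + \<sigma> * sqrt w)\<^sup>2"
      using b \<sigma> w by (simp add: power2_sum)
    finally show "b0\<^sup>2 + energy k (reg T) x y f t \<le> (b + \<sigma> * sqrt w)\<^sup>2" .
  qed
  finally have "sqrt ((rmean k (reg T) x y t z - f z)\<^sup>2) \<le> sqrt ((b + \<sigma> * sqrt w)\<^sup>2 * rcov k (reg T) x t z z)"
    by (rule real_sqrt_le_mono)
  also have "\<dots> = (b + \<sigma> * sqrt w) * sqrt (rcov k (reg T) x t z z)"
    using b \<sigma> w by (simp add: real_sqrt_mult)
  finally show ?thesis
    by (simp add: post_mean_eq_rmean[OF psd] post_sd_def post_cov_eq_rcov[OF psd] conf_radius_def w_def)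
qed

text \<open>The constants in the radius are absorbed by the gain, which needs a positive lower bound
  on it uniform in the horizon. This fails only if the kernel vanishes on the diagonal of
  \<open>X\<close>, and then both sides are 0.\<close>

lemma regret_bound_bigo:
  assumes b: "0 \<le> b" and \<sigma>: "0 < \<sigma>" and \<delta>: "0 < \<delta>" "\<delta> < 1"
  shows "(\<lambda>T. 4 * conf_radius k X b \<sigma> N \<delta> T T * sqrt ((real T + 2) * max_info_gain k X T T))
    \<in> O(\<lambda>T. max_info_gain k X T T * sqrt (real T))"
proof (cases "\<forall>z\<in>X. k z z = 0")
  case True
  have "max_info_gain k X T t \<le> 0" for T t
    unfolding max_info_gain_eq[OF psd]
  proof (rule cSUP_least)
    show "{x. \<forall>a\<in>{1..t}. x a \<in> X} \<noteq> {}" using nonempty by auto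
  next
    fix x assume x: "x \<in> {x. \<forall>a\<in>{1..t}. x a \<in> X}"
    have "rcov k (reg T) x j (x (Suc j)) (x (Suc j)) = 0" if "j < t" for j
      using rcov_le[OF psd reg_ge_one[of T], of x j "x (Suc j)"] rcov_nonneg[OF psd reg_ge_one[of T], of x j "x (Suc j)"]
        True x that by auto
    then show "info_gain k (reg T) x t \<le> 0" by (simp add: info_gain_def)
  qed
  then have "max_info_gain k X T t = 0" for T t using max_info_gain_nonneg[of T t] by (intro antisym)
  then show ?thesis by simp
next
  case False
  then obtain p where p: "p \<in> X" "k p p \<noteq> 0" by auto
  \<comment> \<open>\<open>reg T \<le> 3\<close> for \<open>T \<ge> 1\<close>, so \<open>g\<close>
    bounds from below the gain of a single query at \<open>p\<close> for every horizon.\<close>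
  define g where "g = ln (1 + k p p / 3) / 2"
  have kp: "0 < k p p" using p psd_kernel_diag_nonneg[OF psd, of p] by simp
  then have g: "0 < g" by (simp add: g_def)
  define L where "L = ln ((real N + 1) / \<delta>)"
  have L: "0 \<le> L" unfolding L_def using \<delta> by (intro ln_ge_zero) simp
  \<comment> \<open>From \<open>1 \<le> m / g\<close>: each constant \<open>a\<close> is at most
    \<open>a * m / g\<close>, and \<open>b\<close> at most \<open>b * sqrt (m / g)\<close>.\<close>
  define C where "C = b / sqrt g + \<sigma> * sqrt (2 * (1 + (1 + L) / g))"
  have C: "0 \<le> C" using b \<sigma> g L by (simp add: C_def)
  have "norm (4 * conf_radius k X b \<sigma> N \<delta> T T * sqrt ((real T + 2) * max_info_gain k X T T))
      \<le> 4 * C * sqrt 3 * norm (max_info_gain k X T T * sqrt (real T))" if T: "1 \<le> T" for T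
  proof -
    define m where "m = max_info_gain k X T T"
    have "g \<le> info_gain k (reg T) (\<lambda>_. p) 1"
    proof -
      have "reg T \<le> 3" using T by (simp add: reg_def field_simps)
      then have "k p p / 3 \<le> k p p / reg T" using kp reg_ge_one[of T] by (intro divide_left_mono) auto
      then have "ln (1 + k p p / 3) \<le> ln (1 + k p p / reg T)"
        using kp by (intro ln_mono) (auto simp: add_pos_pos)
      then show ?thesis by (simp add: g_def info_gain_def)
    qed
    also have "\<dots> \<le> info_gain k (reg T) (\<lambda>_. p) T" by (rule info_gain_mono[OF T])
    also have "\<dots> \<le> m" unfolding m_def by (rule info_gain_le_max) (use p in simp)
    finally have m: "g \<le> m" .
    then have m0: "0 < m" using g by simp
    have "b \<le> b / sqrt g * sqrt m"
      using b g m m0 by (simp add: field_simps mult_left_mono)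
    moreover have "sqrt (2 * (max_info_gain k X T (T - 1) + 1 + L)) \<le> sqrt (2 * (1 + (1 + L) / g)) * sqrt m"
    proof -
      have "(1 + L) * g \<le> (1 + L) * m" using m L by (intro mult_left_mono) simp_all
      then have "1 + L \<le> (1 + L) / g * m" using g by (simp add: pos_le_divide_eq)
      moreover have "max_info_gain k X T (T - 1) \<le> m" unfolding m_def by (rule max_info_gain_mono) simp
      ultimately have "2 * (max_info_gain k X T (T - 1) + 1 + L) \<le> 2 * (1 + (1 + L) / g) * m"
        unfolding mult.assoc distrib_right[of 1] by simp
      then show ?thesis unfolding real_sqrt_mult[symmetric] by (rule real_sqrt_le_mono)
    qed
    ultimately have "conf_radius k X b \<sigma> N \<delta> T T \<le> C * sqrt m"
      unfolding conf_radius_def L_def[symmetric] C_def distrib_right mult.assoc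
      using \<sigma> by (intro add_mono mult_left_mono) (auto simp: mult.assoc)
    \<comment> \<open>The 3 comes from \<open>T + 2 \<le> 3 * T\<close>.\<close>
    moreover have "sqrt ((real T + 2) * m) \<le> sqrt 3 * sqrt (real T) * sqrt m"
      unfolding real_sqrt_mult[symmetric] using T m0 by (intro real_sqrt_le_mono mult_right_mono) auto
    moreover have "0 \<le> conf_radius k X b \<sigma> N \<delta> T T"
      using b \<sigma> \<delta> by (intro conf_radius_nonneg) simp_all
    ultimately have "conf_radius k X b \<sigma> N \<delta> T T * sqrt ((real T + 2) * m) \<le>
        (C * sqrt m) * (sqrt 3 * sqrt (real T) * sqrt m)"
      using C m0 by (intro mult_mono) auto
    also have "\<dots> = C * sqrt 3 * (m * sqrt (real T))" using m0 by simp
    finally show ?thesis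
      using m0 \<open>0 \<le> conf_radius k X b \<sigma> N \<delta> T T\<close> unfolding m_def[symmetric]
      by (simp add: abs_mult)
  qed
  then show ?thesis
    by (intro bigoI[where c = "4 * C * sqrt 3"] eventually_sequentiallyI[of 1]) auto
qed

end

section \<open>Runs of the algorithm\<close>

text \<open>An observation combines a noise variable with the value of \<open>h i\<close> at an
  earlier query. Strong induction therefore removes the observations and leaves a function of past
  noise.\<close>

lemma config_run_adapted:
  fixes x :: "nat \<Rightarrow> 'w \<Rightarrow> 'a::second_countable_topology"
  assumes run: "config_run M k X B \<sigma> N \<delta> T h \<xi> x"
    and h: "\<And>i. i \<in> {0..N} \<Longrightarrow> h i \<in> borel_measurable borel"
    and t: "t < T"
  shows "x (Suc t) \<in> borel_measurable (noise_algebra M \<xi> ({0..N} \<times> {1..t}))"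
  using t
proof (induction t rule: less_induct)
  case (less t)
  let ?F = "noise_algebra M \<xi> ({0..N} \<times> {1..t})"
  from run less.prems obtain q where
    q: "q \<in> borel_measurable (PiM ({0..N} \<times> {1..<Suc t}) (\<lambda>_. borel))"
    and x_eq: "\<And>\<omega>. \<omega> \<in> space M \<Longrightarrow> x (Suc t) \<omega> = q (history N (observation h \<xi> x) (Suc t) \<omega>)"
    unfolding config_run_def by (metis Suc_leI atLeastAtMost_iff le_add1 plus_1_eq_Suc)
  have obs: "observation h \<xi> x i s \<in> borel_measurable ?F" if "i \<in> {0..N}" "s \<in> {1..t}" for i s
  proof -
    obtain s' where s': "s = Suc s'" "s' < t" using \<open>s \<in> {1..t}\<close> by (cases s) auto
    have "x s \<in> borel_measurable (noise_algebra M \<xi> ({0..N} \<times> {1..s'}))"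
      unfolding s' using s' less.prems by (intro less.IH) auto
    moreover have "subalgebra ?F (noise_algebra M \<xi> ({0..N} \<times> {1..s'}))"
      by (rule subalgebra_noise_algebra) (use s' in \<open>auto intro!: noise_algebra_measurable\<close>)
    ultimately have "x s \<in> borel_measurable ?F" by (rule measurable_from_subalg[rotated])
    moreover have "\<xi> i s \<in> borel_measurable ?F" by (rule noise_algebra_measurable) (use that in simp)
    ultimately show ?thesis unfolding observation_def[abs_def]
      by (intro borel_measurable_add measurable_compose[OF _ h[OF \<open>i \<in> {0..N}\<close>]])
  qed
  have "history N (observation h \<xi> x) (Suc t) \<in> measurable ?F (PiM ({0..N} \<times> {1..<Suc t}) (\<lambda>_. borel))"
    unfolding history_def by (rule measurable_restrict) (use obs in auto)
  from measurable_compose[OF this q] show ?case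
    by (subst measurable_cong[where g = "\<lambda>\<omega>. q (history N (observation h \<xi> x) (Suc t) \<omega>)"]) (simp_all add: x_eq)
qed

theorem theorem4p3:
  fixes M :: "'w measure"
    and X :: "(real ^ 'd) set"
    and f :: "real ^ 'd \<Rightarrow> real"
    and g :: "nat \<Rightarrow> real ^ 'd \<Rightarrow> real"
    and h :: "nat \<Rightarrow> real ^ 'd \<Rightarrow> real"
    and k :: "nat \<Rightarrow> real ^ 'd \<Rightarrow> real ^ 'd \<Rightarrow> real"
    and H :: "nat \<Rightarrow> (real ^ 'd \<Rightarrow> real) set"
    and ip :: "nat \<Rightarrow> (real ^ 'd \<Rightarrow> real) \<Rightarrow> (real ^ 'd \<Rightarrow> real) \<Rightarrow> real"
    and B :: "nat \<Rightarrow> real"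
    and \<xi> :: "nat \<Rightarrow> nat \<Rightarrow> 'w \<Rightarrow> real"
    and N :: nat
    and \<sigma> \<delta> fstar :: real
    and xstar :: "real ^ 'd"
  assumes "prob_space M"
    and "compact X"
    and "\<And>i. i \<in> {0..N} \<Longrightarrow> psd_kernel (k i)"
    and "\<And>i. i \<in> {0..N} \<Longrightarrow> rkhs (k i) (H i) (ip i)"
    \<comment> \<open>normalisation and measurability of the kernels\<close>
    and "\<And>i z. i \<in> {0..N} \<Longrightarrow> z \<in> X \<Longrightarrow> k i z z \<le> 1"
    and "\<And>i. i \<in> {0..N} \<Longrightarrow> (\<lambda>(z, z'). k i z z') \<in> borel_measurable borel"
    and "f \<in> H 0" and "ip_norm (ip 0) f \<le> B 0"
    and "\<And>i. i \<in> {1..N} \<Longrightarrow> g i \<in> H i \<and> ip_norm (ip i) (g i) \<le> B i"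
    and "xstar \<in> X" and "\<And>i. i \<in> {1..N} \<Longrightarrow> g i xstar \<le> 0"
    and "\<And>z. z \<in> X \<Longrightarrow> (\<And>i. i \<in> {1..N} \<Longrightarrow> g i z \<le> 0) \<Longrightarrow> f xstar \<le> f z"
    and "fstar = f xstar"
    and "\<sigma> > 0" and "0 < \<delta>" and "\<delta> < 1"
    and "iid_sub_gaussian_noise M N \<sigma> \<xi>"
    and "h = (\<lambda>i. if i = 0 then f else g i)"
  shows
    "(\<forall>T\<ge>1. \<forall>x. config_run M k X B \<sigma> N \<delta> T h \<xi> x \<longrightarrow>
        (\<exists>E\<in>sets M. measure M E \<ge> 1 - \<delta> \<and>
          (\<forall>\<omega>\<in>E.
             (\<forall>t\<in>{1..T}. config_candidates k X B \<sigma> N \<delta> T h \<xi> x t \<omega> \<noteq> {}) \<and>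
             (\<Sum>t=1..T. f (x t \<omega>) - fstar) \<le> (\<Sum>t=1..T. max 0 (f (x t \<omega>) - fstar)) \<and>
             (\<Sum>t=1..T. max 0 (f (x t \<omega>) - fstar))
               \<le> 4 * conf_radius (k 0) X (B 0) \<sigma> N \<delta> T T
                   * sqrt ((real T + 2) * max_info_gain (k 0) X T T) \<and>
             (\<forall>i\<in>{1..N}. (\<Sum>t=1..T. max 0 (g i (x t \<omega>)))
               \<le> 4 * conf_radius (k i) X (B i) \<sigma> N \<delta> T T
                   * sqrt ((real T + 2) * max_info_gain (k i) X T T))))) \<and>
     (\<forall>i\<in>{0..N}.
        (\<lambda>T. 4 * conf_radius (k i) X (B i) \<sigma> N \<delta> T T
               * sqrt ((real T + 2) * max_info_gain (k i) X T T))
          \<in> O(\<lambda>T. max_info_gain (k i) X T T * sqrt (real T)))"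
proof -
  interpret prob_space M by fact
  note psd = assms(3) and rk = assms(4) and le_one = assms(5) and k_meas = assms(6)
  note xstar = assms(10,11) and fstar = assms(13) and \<sigma> = assms(14) and \<delta> = assms(15,16)
  note noise = assms(17) and h_def = assms(18)
  have bk: "bounded_kernel (k i) X" if "i \<in> {0..N}" for i
    using psd[OF that] le_one[OF that] xstar(1) by unfold_locales auto
  have hH: "h i \<in> H i" "ip_norm (ip i) (h i) \<le> B i" if "i \<in> {0..N}" for i
    using assms(7-9) that by (auto simp: h_def)
  define b0 where "b0 i = ip_norm (ip i) (h i)" for i
  have b0: "0 \<le> b0 i" "b0 i \<le> B i" and b0_sq: "(b0 i)\<^sup>2 = ip i (h i) (h i)" if "i \<in> {0..N}" for i
    using hH[OF that] rkhs.ip_nonneg[OF rk[OF that]] by (auto simp: b0_def ip_norm_def)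
  have dom: "dominated (k i) ((b0 i)\<^sup>2) (\<lambda>z. - h i z)" if "i \<in> {0..N}" for i
    unfolding b0_sq[OF that] by (rule rkhs.dominated_neg[OF rk[OF that] hH(1)[OF that]])
  \<comment> \<open>Measurability of the unknown functions is inherited from the kernel sections;
    without it the observations would not be known to be random variables.\<close>
  have h_meas: "h i \<in> borel_measurable borel" if i: "i \<in> {0..N}" for i
  proof (rule dominated_measurable[OF dom[OF i] psd[OF i]])
    fix z :: "real ^ 'd"
    from measurable_compose[OF borel_measurable_Pair[OF borel_measurable_const measurable_ident_sets[OF refl]] k_meas[OF i]]
    show "(\<lambda>z'. k i z z') \<in> borel_measurable borel" by simp
  qed
  have "\<exists>E\<in>sets M. measure M E \<ge> 1 - \<delta> \<and>
          (\<forall>\<omega>\<in>E.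
             (\<forall>t\<in>{1..T}. config_candidates k X B \<sigma> N \<delta> T h \<xi> x t \<omega> \<noteq> {}) \<and>
             (\<Sum>t=1..T. f (x t \<omega>) - fstar) \<le> (\<Sum>t=1..T. max 0 (f (x t \<omega>) - fstar)) \<and>
             (\<Sum>t=1..T. max 0 (f (x t \<omega>) - fstar))
               \<le> 4 * conf_radius (k 0) X (B 0) \<sigma> N \<delta> T T
                   * sqrt ((real T + 2) * max_info_gain (k 0) X T T) \<and>
             (\<forall>i\<in>{1..N}. (\<Sum>t=1..T. max 0 (g i (x t \<omega>)))
               \<le> 4 * conf_radius (k i) X (B i) \<sigma> N \<delta> T T
                   * sqrt ((real T + 2) * max_info_gain (k i) X T T)))"
    if T: "1 \<le> T" and run: "config_run M k X B \<sigma> N \<delta> T h \<xi> x" for T x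
  proof -
    \<comment> \<open>Failure probability \<open>\<delta> / (N + 1)\<close> for each of the
      \<open>N + 1\<close> functions.\<close>
    let ?c = "(real N + 1) / \<delta>"
    have c: "0 < ?c" using \<delta> by simp
    define bound where "bound i \<omega> \<longleftrightarrow> (\<forall>t\<le>T.
        energy (k i) (reg T) (\<lambda>s. x s \<omega>) (\<lambda>s. h i (x s \<omega>) + \<xi> i s \<omega>) (h i) t \<le>
          2 * \<sigma>\<^sup>2 * (info_gain (k i) (reg T) (\<lambda>s. x s \<omega>) t + 1 + ln ?c))" for i \<omega>
    have "\<exists>E\<in>sets M. measure M E \<le> 1 / ?c \<and> (\<forall>\<omega>\<in>space M - E. bound i \<omega>)" if i: "i \<in> {0..N}" for i
      unfolding bound_def
      by (rule energy_bound[OF noise _ \<sigma> c psd[OF i] k_meas[OF i] h_meas[OF i] T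
            config_run_adapted[OF run h_meas]]) (use i in auto)
    then have "\<forall>i\<in>{0..N}. \<exists>E. E \<in> sets M \<and> measure M E \<le> 1 / ?c \<and> (\<forall>\<omega>\<in>space M - E. bound i \<omega>)"
      by blast
    from bchoice[OF this] obtain bad where bad: "\<And>i. i \<in> {0..N} \<Longrightarrow> bad i \<in> sets M"
      and bad_le: "\<And>i. i \<in> {0..N} \<Longrightarrow> measure M (bad i) \<le> 1 / ?c"
      and bound: "\<And>i \<omega>. i \<in> {0..N} \<Longrightarrow> \<omega> \<in> space M - bad i \<Longrightarrow> bound i \<omega>"
      by blast
    define E where "E = space M - (\<Union>i\<in>{0..N}. bad i)"
    have U: "(\<Union>i\<in>{0..N}. bad i) \<in> sets M" using bad by (intro sets.finite_UN) auto
    have "measure M (\<Union>i\<in>{0..N}. bad i) \<le> (\<Sum>i\<in>{0..N}. measure M (bad i))"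
      using bad by (intro finite_measure_subadditive_finite) auto
    also have "\<dots> \<le> (\<Sum>i\<in>{0..N}. 1 / ?c)" by (intro sum_mono bad_le)
    also have "\<dots> = \<delta>" by (simp add: add.commute)
    finally have "measure M E \<ge> 1 - \<delta>" unfolding E_def prob_compl[OF U] by simp
    moreover have "E \<in> sets M" unfolding E_def using U by auto
    moreover have "(\<forall>t\<in>{1..T}. config_candidates k X B \<sigma> N \<delta> T h \<xi> x t \<omega> \<noteq> {}) \<and>
             (\<Sum>t=1..T. f (x t \<omega>) - fstar) \<le> (\<Sum>t=1..T. max 0 (f (x t \<omega>) - fstar)) \<and>
             (\<Sum>t=1..T. max 0 (f (x t \<omega>) - fstar))
               \<le> 4 * conf_radius (k 0) X (B 0) \<sigma> N \<delta> T T
                   * sqrt ((real T + 2) * max_info_gain (k 0) X T T) \<and>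
             (\<forall>i\<in>{1..N}. (\<Sum>t=1..T. max 0 (g i (x t \<omega>)))
               \<le> 4 * conf_radius (k i) X (B i) \<sigma> N \<delta> T T
                   * sqrt ((real T + 2) * max_info_gain (k i) X T T))" if \<omega>: "\<omega> \<in> E" for \<omega>
    proof -
      let ?cand = "config_candidates k X B \<sigma> N \<delta> T h \<xi> x"
      let ?low = "\<lambda>i t z. config_lower k X B \<sigma> N \<delta> T h \<xi> x i t \<omega> z"
      let ?w = "\<lambda>i t z. conf_radius (k i) X (B i) \<sigma> N \<delta> T t * post_sd (k i) T (\<lambda>s. x s \<omega>) (t - 1) z"
      have \<omega>M: "\<omega> \<in> space M" using \<omega> by (simp add: E_def)
      \<comment> \<open>Only the queries before step \<open>t\<close> must lie in \<open>X\<close>,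
        which lets the bounds enter the induction below.\<close>
      have lower: "?low i t z \<le> h i z" "h i z \<le> ?low i t z + 2 * ?w i t z"
        if i: "i \<in> {0..N}" and t: "t \<in> {1..T}" and X: "\<forall>s\<in>{1..t - 1}. x s \<omega> \<in> X" for i t z
      proof -
        have "bound i \<omega>" using \<omega> i by (intro bound) (auto simp: E_def)
        moreover have "t - 1 \<le> T" using t unfolding atLeastAtMost_iff by linarith
        ultimately have "energy (k i) (reg T) (\<lambda>s. x s \<omega>) (\<lambda>s. h i (x s \<omega>) + \<xi> i s \<omega>) (h i) (t - 1) \<le>
            2 * \<sigma>\<^sup>2 * (info_gain (k i) (reg T) (\<lambda>s. x s \<omega>) (t - 1) + 1 + ln ?c)"
          unfolding bound_def by blast
        from bounded_kernel.conf_bound[OF bk[OF i] dom[OF i] b0[OF i] \<sigma> \<delta> X this]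
        have "\<bar>post_mean (k i) T (\<lambda>s. x s \<omega>) (\<lambda>s. h i (x s \<omega>) + \<xi> i s \<omega>) (t - 1) z - h i z\<bar> \<le> ?w i t z"
          using t by simp
        then show "?low i t z \<le> h i z" "h i z \<le> ?low i t z + 2 * ?w i t z"
          using t by (auto simp: config_lower_def lower_conf_def observation_def abs_le_iff)
      qed
      have xstar_cand: "xstar \<in> ?cand t \<omega>" if "t \<in> {1..T}" "\<forall>s\<in>{1..t - 1}. x s \<omega> \<in> X" for t
        unfolding config_candidates_def
      proof (intro CollectI conjI ballI xstar(1))
        fix i assume i: "i \<in> {1..N}"
        then have "?low i t xstar \<le> h i xstar" by (intro lower that) simp
        also have "\<dots> \<le> 0" using xstar(2)[OF i] i by (simp add: h_def)
        finally show "?low i t xstar \<le> 0" .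
      qed
      have argmin: "is_arg_min (?low 0 t) (\<lambda>z. z \<in> ?cand t \<omega>) (x t \<omega>)"
        if "t \<in> {1..T}" "\<forall>s\<in>{1..t}. ?cand s \<omega> \<noteq> {}" for t
        using run that \<omega>M unfolding config_run_def by blast
      \<comment> \<open>Earlier queries in \<open>X\<close> give valid bounds at this step, hence
        \<open>xstar\<close> is a candidate, hence no infeasibility is declared and the new query
        lies in \<open>X\<close>.\<close>
      have inv: "\<forall>s\<in>{1..t}. ?cand s \<omega> \<noteq> {} \<and> x s \<omega> \<in> X" if "t \<le> T" for t
        using that
      proof (induction t)
        case (Suc t)
        then have IH: "\<forall>s\<in>{1..t}. ?cand s \<omega> \<noteq> {} \<and> x s \<omega> \<in> X" by simp
        have "xstar \<in> ?cand (Suc t) \<omega>" using Suc.prems IH by (intro xstar_cand) auto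
        then have cand: "\<forall>s\<in>{1..Suc t}. ?cand s \<omega> \<noteq> {}" using IH by (auto simp: le_Suc_eq)
        then have "x (Suc t) \<omega> \<in> ?cand (Suc t) \<omega>"
          using argmin[of "Suc t"] Suc.prems by (simp add: is_arg_min_def)
        then have "x (Suc t) \<omega> \<in> X" by (simp add: config_candidates_def)
        then show ?case using IH cand by (auto simp: le_Suc_eq)
      qed simp
      have X: "\<forall>s\<in>{1..T}. x s \<omega> \<in> X" using inv[of T] by blast
      have X': "\<forall>s\<in>{1..t - 1}. x s \<omega> \<in> X" if "t \<in> {1..T}" for t using X that by auto
      have am: "is_arg_min (?low 0 t) (\<lambda>z. z \<in> ?cand t \<omega>) (x t \<omega>)" if "t \<in> {1..T}" for t
        using inv[of T] that by (intro argmin) auto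
      have w_mono: "?w i t z \<le> conf_radius (k i) X (B i) \<sigma> N \<delta> T T * post_sd (k i) T (\<lambda>s. x s \<omega>) (t - 1) z"
        and w_nonneg: "0 \<le> ?w i t z" if i: "i \<in> {0..N}" and t: "t \<in> {1..T}" for i t z
      proof -
        have sd: "0 \<le> post_sd (k i) T (\<lambda>s. x s \<omega>) (t - 1) z"
          using rcov_nonneg[OF psd[OF i] reg_ge_one] by (simp add: post_sd_def post_cov_eq_rcov[OF psd[OF i]])
        show "?w i t z \<le> conf_radius (k i) X (B i) \<sigma> N \<delta> T T * post_sd (k i) T (\<lambda>s. x s \<omega>) (t - 1) z"
          using \<sigma> t by (intro mult_right_mono bounded_kernel.conf_radius_mono[OF bk[OF i]] sd) auto
        show "0 \<le> ?w i t z"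
          by (intro mult_nonneg_nonneg sd bounded_kernel.conf_radius_nonneg[OF bk[OF i]]) (use b0[OF i] \<sigma> \<delta> in auto)
      qed
      \<comment> \<open>The 4 is 2 from twice the width times 2 from the bound on the sum of
        standard deviations; the radius at \<open>T\<close> dominates all earlier ones.\<close>
      have sum: "(\<Sum>t=1..T. r t) \<le> 4 * conf_radius (k i) X (B i) \<sigma> N \<delta> T T
          * sqrt ((real T + 2) * max_info_gain (k i) X T T)"
        if i: "i \<in> {0..N}" and r: "\<And>t. t \<in> {1..T} \<Longrightarrow> r t \<le> 2 * ?w i t (x t \<omega>)" for i r
      proof -
        let ?b = "conf_radius (k i) X (B i) \<sigma> N \<delta> T T"
        have b: "0 \<le> ?b" by (rule bounded_kernel.conf_radius_nonneg[OF bk[OF i]]) (use b0[OF i] \<sigma> \<delta> in auto)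
        have "(\<Sum>t=1..T. r t) \<le> (\<Sum>t=1..T. 2 * (?b * post_sd (k i) T (\<lambda>s. x s \<omega>) (t - 1) (x t \<omega>)))"
        proof (rule sum_mono)
          fix t assume t: "t \<in> {1..T}"
          show "r t \<le> 2 * (?b * post_sd (k i) T (\<lambda>s. x s \<omega>) (t - 1) (x t \<omega>))"
            using r[OF t] w_mono[OF i t, of "x t \<omega>"] by linarith
        qed
        also have "\<dots> = 2 * ?b * (\<Sum>t=1..T. post_sd (k i) T (\<lambda>s. x s \<omega>) (t - 1) (x t \<omega>))"
          by (simp add: sum_distrib_left mult.assoc)
        also have "\<dots> \<le> 2 * ?b * (2 * sqrt ((real T + 2) * max_info_gain (k i) X T T))"
          using b by (intro mult_left_mono bounded_kernel.sum_sd_le[OF bk[OF i] X T]) simp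
        finally show ?thesis by simp
      qed
      have "max 0 (f (x t \<omega>) - fstar) \<le> 2 * ?w 0 t (x t \<omega>)" if t: "t \<in> {1..T}" for t
      proof -
        have "?low 0 t (x t \<omega>) \<le> ?low 0 t xstar"
          using am[OF t] xstar_cand[OF t X'[OF t]] by (auto simp: is_arg_min_def not_less)
        also have "\<dots> \<le> fstar" using lower(1)[OF _ t X'[OF t], of 0 xstar] by (simp add: h_def fstar)
        finally have "f (x t \<omega>) - fstar \<le> 2 * ?w 0 t (x t \<omega>)"
          using lower(2)[OF _ t X'[OF t], of 0 "x t \<omega>"] by (simp add: h_def)
        then show ?thesis using w_nonneg[OF _ t, of 0 "x t \<omega>"] by simp
      qed
      then have "(\<Sum>t=1..T. max 0 (f (x t \<omega>) - fstar)) \<le> 4 * conf_radius (k 0) X (B 0) \<sigma> N \<delta> T T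
          * sqrt ((real T + 2) * max_info_gain (k 0) X T T)"
        by (intro sum) simp_all
      moreover have "(\<Sum>t=1..T. max 0 (g i (x t \<omega>))) \<le> 4 * conf_radius (k i) X (B i) \<sigma> N \<delta> T T
          * sqrt ((real T + 2) * max_info_gain (k i) X T T)" if i: "i \<in> {1..N}" for i
      proof (rule sum)
        fix t assume t: "t \<in> {1..T}"
        have i0: "i \<in> {0..N}" using i by simp
        have "?low i t (x t \<omega>) \<le> 0"
          using am[OF t] i by (auto simp: is_arg_min_def config_candidates_def)
        then have "g i (x t \<omega>) \<le> 2 * ?w i t (x t \<omega>)"
          using lower(2)[OF i0 t X'[OF t], of "x t \<omega>"] i by (simp add: h_def)
        then show "max 0 (g i (x t \<omega>)) \<le> 2 * ?w i t (x t \<omega>)"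
          using w_nonneg[OF i0 t, of "x t \<omega>"] by simp
      qed (use i in simp)
      moreover have "(\<Sum>t=1..T. f (x t \<omega>) - fstar) \<le> (\<Sum>t=1..T. max 0 (f (x t \<omega>) - fstar))"
        by (intro sum_mono) simp
      ultimately show ?thesis using inv[of T] by blast
    qed
    ultimately show ?thesis by blast
  qed
  moreover have "(\<lambda>T. 4 * conf_radius (k i) X (B i) \<sigma> N \<delta> T T
      * sqrt ((real T + 2) * max_info_gain (k i) X T T)) \<in> O(\<lambda>T. max_info_gain (k i) X T T * sqrt (real T))"
    if i: "i \<in> {0..N}" for i
    by (rule bounded_kernel.regret_bound_bigo[OF bk[OF i] _ \<sigma> \<delta>]) (use b0[OF i] in simp)
  ultimately show ?thesis by blast
qed

end
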